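(* Let $R$ be a ring essentially of finite type over an $F$-finite field and $\mathfrak a\subseteq R$ an ideal. Let $\mathcal C$ be a principal Cartier algebra generated by $\kappa$, let $M$ be an $F$-regular coherent $\mathcal C$-module, and assume that $\mathfrak a$ contains an $M$-regular element. Then the $V$-filtration on $M$ along $\mathfrak a$ exists and $V^t=\tau(M,\mathcal C,\mathfrak a^t)$ for all $t\in\mathbb Q_{\ge0}$ (with $V^t=M$ for $t<0$).
   Context: All rings are commutative, noetherian and contain a field of characteristic $p>0$; $F$ is the Frobenius; $F^e_*M$ is $M$ as an abelian group with $r\cdot m=r^{p^e}m$; $R$ is $F$-finite if $F_*R$ is a finite $R$-module. An $R$-Cartier algebra is an $\mathbb N$-graded $R$-algebra $\mathcal C=\bigoplus_n\mathcal C_n$ such that $R\to\mathcal C$ surjects onto $\mathcal C_0$ and $r\varphi=\varphi r^{p^n}$ for $\varphi\in\mathcal C_n$, $r\in R$; $\mathcal C_+=\bigoplus_{n\ge1}\mathcal C_n$. It is principal if generated by a single $\kappa$ of degree 1; a module over it is an $R$-module $M$ with an $R$-linear map $\kappa:F_*M\to M$ (a principal Cartier module). A left $\mathcal C$-module is coherent if it is finitely generated over $R$. For $t\in\mathbb Q_{\ge0}$ put $\mathcal C^{\mathfrak a^t}=\bigoplus_n\mathcal C_n\mathfrak a^{\lceil t(p^n-1)\rceil}$. For a coherent $\mathcal C$-module $M$ put $\underline M_{\mathcal C}=(\mathcal C_+)^eM$ for $e\gg0$ (this stabilizes). $M$ is $F$-pure if $\mathcal C_+M=M$, and $F$-regular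 if it is $F$-pure and there is no proper non-zero $\mathcal C$-submodule agreeing with $M$ at every generic point of $\operatorname{Supp}M$. The test module $\tau(M,\mathcal C)$ is the smallest $\mathcal C$-submodule of $M$ with $\tau(M,\mathcal C)_\eta=(\underline M_{\mathcal C})_\eta$ for every generic point $\eta$ of $\operatorname{Supp}\underline M_{\mathcal C}$; $\tau(M,\mathcal C,\mathfrak a^t)=\tau(M,\mathcal C^{\mathfrak a^t})$. A $V$-filtration on a principal Cartier module $(M,\kappa)$ along an ideal $\mathfrak a$ is a decreasing, right-continuous (for each $t$, $V^t=V^{t+\varepsilon}$ for all sufficiently small $\varepsilon>0$), $\mathbb Q$-indexed, exhaustive filtration $V^\cdot$ of $M$ by $R$-submodules such that: (i) $V^0$ is coherent and the filtration is continuous in zero; (ii) there is an element $0\ne x\in\mathfrak a$ such that multiplication with $x^j$ induces an injective map $V^t\to V^{t+j}$; (iii) if $\mathfrak a$ is generated by $n$ elements then $V^t=\mathfrak a^nV^{t-n}$ for $t>n$; (iv) $\kappa(V^{tp})=V^t$. The $V$-filtration of a principal Cartier module is unique if it exists.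
   Formalization: Condition (iii) of a V-filtration is corrected: if 𝔞 is generated by n elements, then V^t = 𝔞V^{t-1} for t > n, replacing V^t = 𝔞^n V^{t-n}, which fails for R = M = F_p[x,y] with the trace, 𝔞 = (x,y), t = 5/2. *)

theory Defs
  imports "HOL-Computational_Algebra.Computational_Algebra"
begin

text \<open>
  Ideals of a commutative ring are the submodules \<^term>\<open>I\<close> with
  \<^term>\<open>module.subspace (*) I\<close>.  The additive subgroup generated by a set is
  \<^term>\<open>group_closure\<close> from the library.
\<close>

section \<open>Rings\<close>

text \<open>
  The target is only required to be in class \<open>ring\<close>, which has no distinguished unit, so that the
  zero ring is allowed; the image of \<open>1\<close> then has to be a unit element.
\<close>
definition unital_hom :: "('a::ring_1 \<Rightarrow> 'b::ring) \<Rightarrow> bool" where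
  "unital_hom f \<longleftrightarrow> (\<forall>x y. f (x + y) = f x + f y) \<and> (\<forall>x y. f (x * y) = f x * f y) \<and>
     (\<forall>b. f 1 * b = b \<and> b * f 1 = b)"

definition ring_generated_by :: "'b::ring set \<Rightarrow> bool" where
  "ring_generated_by G \<longleftrightarrow>
     (\<forall>A. G \<subseteq> A \<and> 0 \<in> A \<and> (\<forall>x\<in>A. \<forall>y\<in>A. x - y \<in> A \<and> x * y \<in> A) \<longrightarrow> A = UNIV)"

definition finite_type :: "('k::comm_ring_1 \<Rightarrow> 'b::comm_ring_1) \<Rightarrow> bool" where
  "finite_type f \<longleftrightarrow> unital_hom f \<and> (\<exists>X. finite X \<and> ring_generated_by (range f \<union> X))"

text \<open>\<open>l\<close> exhibits its codomain as the localization of its domain at the multiplicative set \<open>S\<close>.\<close>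
definition is_localization :: "'b::comm_ring_1 set \<Rightarrow> ('b \<Rightarrow> 'r::comm_ring_1) \<Rightarrow> bool" where
  "is_localization S l \<longleftrightarrow> unital_hom l \<and> 1 \<in> S \<and> (\<forall>s\<in>S. \<forall>s'\<in>S. s * s' \<in> S) \<and>
     (\<forall>s\<in>S. l s dvd 1) \<and>
     (\<forall>r. \<exists>b. \<exists>s\<in>S. r * l s = l b) \<and>
     (\<forall>b. l b = 0 \<longleftrightarrow> (\<exists>s\<in>S. s * b = 0))"

text \<open>\<open>R\<close> is a localization, via \<open>l\<close>, of a finitely generated algebra \<open>f\<close> over the domain of \<open>f\<close>.\<close>
definition ess_finite_type :: "('k::comm_ring_1 \<Rightarrow> 'b::comm_ring_1) \<Rightarrow> ('b \<Rightarrow> 'r::comm_ring_1) \<Rightarrow> bool" where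
  "ess_finite_type f l \<longleftrightarrow> finite_type f \<and> (\<exists>S. is_localization S l)"

definition noetherian :: "'r::comm_ring_1 itself \<Rightarrow> bool" where
  "noetherian _ \<longleftrightarrow>
     (\<forall>I::'r set. module.subspace (*) I \<longrightarrow> (\<exists>X. finite X \<and> module.span (*) X = I))"

text \<open>The \<open>R\<close>-module structure of \<open>F\<^sup>e\<^sub>*M\<close>.\<close>
definition frob_scale :: "nat \<Rightarrow> nat \<Rightarrow> ('r::comm_ring_1 \<Rightarrow> 'm \<Rightarrow> 'm) \<Rightarrow> 'r \<Rightarrow> 'm \<Rightarrow> 'm" where
  "frob_scale p e scale r m = scale (r ^ (p ^ e)) m"

text \<open>A submodule \<open>N\<close> is finitely generated; for \<open>\<C>\<close>-modules this is coherence.\<close>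
definition fin_gen :: "('r::comm_ring_1 \<Rightarrow> 'm::ab_group_add \<Rightarrow> 'm) \<Rightarrow> 'm set \<Rightarrow> bool" where
  "fin_gen scale N \<longleftrightarrow> (\<exists>X. finite X \<and> module.span scale X = N)"

definition F_finite :: "nat \<Rightarrow> 'r::comm_ring_1 itself \<Rightarrow> bool" where
  "F_finite p _ \<longleftrightarrow> fin_gen (frob_scale p 1 ((*) :: 'r \<Rightarrow> 'r \<Rightarrow> 'r)) UNIV"

definition prime_ideal :: "'r::comm_ring_1 set \<Rightarrow> bool" where
  "prime_ideal P \<longleftrightarrow> module.subspace (*) P \<and> P \<noteq> UNIV \<and> (\<forall>x y. x * y \<in> P \<longrightarrow> x \<in> P \<or> y \<in> P)"

definition ideal_times :: "('r::comm_ring_1 \<Rightarrow> 'm::ab_group_add \<Rightarrow> 'm) \<Rightarrow> 'r set \<Rightarrow> 'm set \<Rightarrow> 'm set" where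
  "ideal_times scale I N = group_closure {scale r m |r m. r \<in> I \<and> m \<in> N}"

definition ideal_power :: "'r::comm_ring_1 set \<Rightarrow> nat \<Rightarrow> 'r set" where
  "ideal_power I k = (ideal_times (*) I ^^ k) UNIV"

text \<open>
  A nonzero element that is not a zero divisor on \<open>M\<close>.  The condition \<open>x \<noteq> 0\<close> is automatic
  unless \<open>M = 0\<close>; \<open>M / xM \<noteq> 0\<close> is not required.
\<close>
definition regular_element :: "('r::comm_ring_1 \<Rightarrow> 'm::ab_group_add \<Rightarrow> 'm) \<Rightarrow> 'r \<Rightarrow> bool" where
  "regular_element scale x \<longleftrightarrow> x \<noteq> 0 \<and> (\<forall>m. scale x m = 0 \<longrightarrow> m = 0)"

section \<open>Localization of submodules and generic points of supports\<close>

definition frac_rel ::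
  "('r::comm_ring_1 \<Rightarrow> 'm::ab_group_add \<Rightarrow> 'm) \<Rightarrow> 'r set \<Rightarrow> (('m \<times> 'r) \<times> ('m \<times> 'r)) set" where
  "frac_rel scale P = {((m, s), (m', s')). s \<notin> P \<and> s' \<notin> P \<and>
     (\<exists>u. u \<notin> P \<and> scale (u * s') m = scale (u * s) m')}"

text \<open>The image of \<open>N\<^sub>P\<close> in \<open>M\<^sub>P\<close>, whose elements \<open>m/s\<close> are classes of \<open>frac_rel\<close>.\<close>
definition localized ::
  "('r::comm_ring_1 \<Rightarrow> 'm::ab_group_add \<Rightarrow> 'm) \<Rightarrow> 'r set \<Rightarrow> 'm set \<Rightarrow> ('m \<times> 'r) set set" where
  "localized scale P N = {frac_rel scale P `` {(m, s)} |m s. m \<in> N \<and> s \<notin> P}"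

definition supp :: "('r::comm_ring_1 \<Rightarrow> 'm::ab_group_add \<Rightarrow> 'm) \<Rightarrow> 'm set \<Rightarrow> 'r set set" where
  "supp scale N = {P. prime_ideal P \<and> localized scale P N \<noteq> localized scale P {0}}"

definition generic_points :: "('r::comm_ring_1 \<Rightarrow> 'm::ab_group_add \<Rightarrow> 'm) \<Rightarrow> 'm set \<Rightarrow> 'r set set" where
  "generic_points scale N = {P \<in> supp scale N. \<forall>Q \<in> supp scale N. Q \<subseteq> P \<longrightarrow> Q = P}"

section \<open>Cartier algebras and their modules\<close>

text \<open>
  An \<open>R\<close>-Cartier algebra: the structure map \<open>\<iota> : R \<rightarrow> \<C>\<close> need not have central image, and
  \<open>C n\<close> is the homogeneous part of degree \<open>n\<close>.
\<close>
definition cartier_algebra :: "nat \<Rightarrow> ('r::comm_ring_1 \<Rightarrow> 'c::ring) \<Rightarrow> (nat \<Rightarrow> 'c set) \<Rightarrow> bool" where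
  "cartier_algebra p \<iota> C \<longleftrightarrow> unital_hom \<iota> \<and>
     (\<forall>n. group_closure (C n) = C n) \<and>
     (\<forall>c. \<exists>!f. finite {n. f n \<noteq> 0} \<and> (\<forall>n. f n \<in> C n) \<and> c = (\<Sum>n | f n \<noteq> 0. f n)) \<and>
     (\<forall>i j. \<forall>c\<in>C i. \<forall>d\<in>C j. c * d \<in> C (i + j)) \<and>
     range \<iota> = C 0 \<and>
     (\<forall>n r. \<forall>c\<in>C n. \<iota> r * c = c * \<iota> (r ^ (p ^ n)))"

definition principal_cartier_algebra ::
  "nat \<Rightarrow> ('r::comm_ring_1 \<Rightarrow> 'c::ring) \<Rightarrow> (nat \<Rightarrow> 'c set) \<Rightarrow> 'c \<Rightarrow> bool" where
  "principal_cartier_algebra p \<iota> C \<kappa> \<longleftrightarrow>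
     cartier_algebra p \<iota> C \<and> \<kappa> \<in> C 1 \<and> ring_generated_by (insert \<kappa> (range \<iota>))"

text \<open>A left \<open>\<C>\<close>-module; the underlying \<open>R\<close>-module structure is the one induced by \<open>\<iota>\<close>.\<close>
definition cartier_module ::
  "('r::comm_ring_1 \<Rightarrow> 'c::ring) \<Rightarrow> ('r \<Rightarrow> 'm::ab_group_add \<Rightarrow> 'm) \<Rightarrow> ('c \<Rightarrow> 'm \<Rightarrow> 'm) \<Rightarrow> bool" where
  "cartier_module \<iota> scale act \<longleftrightarrow> module scale \<and>
     (\<forall>c m m'. act c (m + m') = act c m + act c m') \<and>
     (\<forall>c d m. act (c + d) m = act c m + act d m) \<and>
     (\<forall>c d m. act (c * d) m = act c (act d m)) \<and>
     (\<forall>r m. act (\<iota> r) m = scale r m)"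

text \<open>
  In the following, \<open>D\<close> is the family of homogeneous parts of a graded subalgebra of \<open>\<C>\<close>
  (such as \<open>\<C>\<close> itself or \<open>\<C>\<close> twisted by \<open>\<aa>\<^sup>t\<close>), acting on \<open>M\<close> by restriction of the action of \<open>\<C>\<close>.
\<close>

definition cartier_submodule ::
  "('r::comm_ring_1 \<Rightarrow> 'm::ab_group_add \<Rightarrow> 'm) \<Rightarrow> ('c \<Rightarrow> 'm \<Rightarrow> 'm) \<Rightarrow> (nat \<Rightarrow> 'c set) \<Rightarrow> 'm set \<Rightarrow> bool" where
  "cartier_submodule scale act D N \<longleftrightarrow>
     module.subspace scale N \<and> (\<forall>n. \<forall>c\<in>D n. \<forall>m\<in>N. act c m \<in> N)"

text \<open>\<open>\<C>\<^sub>+ N\<close>\<close>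
definition plus_image :: "('c \<Rightarrow> 'm::ab_group_add \<Rightarrow> 'm) \<Rightarrow> (nat \<Rightarrow> 'c set) \<Rightarrow> 'm set \<Rightarrow> 'm set" where
  "plus_image act D N = group_closure {act c m |c m n. 1 \<le> n \<and> c \<in> D n \<and> m \<in> N}"

text \<open>The eventual value of \<open>(\<C>\<^sub>+)\<^sup>e M\<close> for large \<open>e\<close>.\<close>
definition stable_image :: "('c \<Rightarrow> 'm::ab_group_add \<Rightarrow> 'm) \<Rightarrow> (nat \<Rightarrow> 'c set) \<Rightarrow> 'm set" where
  "stable_image act D = (THE U. \<forall>\<^sub>F e in sequentially. (plus_image act D ^^ e) UNIV = U)"

definition F_pure :: "('c \<Rightarrow> 'm::ab_group_add \<Rightarrow> 'm) \<Rightarrow> (nat \<Rightarrow> 'c set) \<Rightarrow> bool" where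
  "F_pure act D \<longleftrightarrow> plus_image act D UNIV = UNIV"

definition F_regular ::
  "('r::comm_ring_1 \<Rightarrow> 'm::ab_group_add \<Rightarrow> 'm) \<Rightarrow> ('c \<Rightarrow> 'm \<Rightarrow> 'm) \<Rightarrow> (nat \<Rightarrow> 'c set) \<Rightarrow> bool" where
  "F_regular scale act D \<longleftrightarrow> F_pure act D \<and>
     \<not> (\<exists>N. cartier_submodule scale act D N \<and> N \<noteq> UNIV \<and> N \<noteq> {0} \<and>
          (\<forall>P \<in> generic_points scale UNIV. localized scale P N = localized scale P UNIV))"

text \<open>\<open>T = \<tau>(M, D)\<close>, i.e. the smallest submodule of the required kind exists and equals \<open>T\<close>.\<close>
definition is_test_module ::
  "('r::comm_ring_1 \<Rightarrow> 'm::ab_group_add \<Rightarrow> 'm) \<Rightarrow> ('c \<Rightarrow> 'm \<Rightarrow> 'm) \<Rightarrow> (nat \<Rightarrow> 'c set) \<Rightarrow> 'm set \<Rightarrow> bool" where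
  "is_test_module scale act D T \<longleftrightarrow>
     (let U = stable_image act D;
          admissible = (\<lambda>N. cartier_submodule scale act D N \<and>
            (\<forall>P \<in> generic_points scale U. localized scale P N = localized scale P U))
      in admissible T \<and> (\<forall>N. admissible N \<longrightarrow> T \<subseteq> N))"

text \<open>The homogeneous parts \<open>\<C>\<^sub>n \<aa>\<^bsup>\<lceil>t(p\<^sup>n - 1)\<rceil>\<^esup>\<close> of \<open>\<C>\<close> twisted by \<open>\<aa>\<^sup>t\<close>; only used for \<open>t \<ge> 0\<close>.\<close>
definition twist ::
  "nat \<Rightarrow> ('r::comm_ring_1 \<Rightarrow> 'c::ring) \<Rightarrow> (nat \<Rightarrow> 'c set) \<Rightarrow> 'r set \<Rightarrow> rat \<Rightarrow> nat \<Rightarrow> 'c set" where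
  "twist p \<iota> C \<aa> t n =
     group_closure {c * \<iota> r |c r. c \<in> C n \<and> r \<in> ideal_power \<aa> (nat \<lceil>t * (of_nat p ^ n - 1)\<rceil>)}"

section \<open>V-filtrations\<close>

definition principal_cartier_module ::
  "nat \<Rightarrow> ('r::comm_ring_1 \<Rightarrow> 'm::ab_group_add \<Rightarrow> 'm) \<Rightarrow> ('m \<Rightarrow> 'm) \<Rightarrow> bool" where
  "principal_cartier_module p scale k \<longleftrightarrow> module_hom (frob_scale p 1 scale) scale k"

text \<open>
  Continuity in zero is the two-sided version of right-continuity at \<open>t = 0\<close>.

  The next to last condition is the Skoda-type condition \<open>V\<^sup>t = \<aa> V\<^bsup>t-1\<^esup>\<close> for \<open>t > n\<close>, if \<open>\<aa>\<close> has \<open>n\<close>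
  generators.  In the literature one also finds \<open>V\<^sup>t = \<aa>\<^sup>n V\<^bsup>t-n\<^esup>\<close> for \<open>t > n\<close>.  For \<open>n = 1\<close> this is the
  same, but for \<open>n \<ge> 2\<close> test module filtrations do not satisfy it: for \<open>M = R = k[x,y]\<close> with the trace
  \<open>\<kappa>\<close> and \<open>\<aa> = (x,y)\<close> one has \<open>\<tau>(\<aa>\<^bsup>5/2\<^esup>) = \<aa>\<close>, whereas \<open>\<aa>\<^sup>2 \<tau>(\<aa>\<^bsup>1/2\<^esup>) = \<aa>\<^sup>2\<close>.
\<close>
definition is_V_filtration ::
  "nat \<Rightarrow> ('r::comm_ring_1 \<Rightarrow> 'm::ab_group_add \<Rightarrow> 'm) \<Rightarrow> ('m \<Rightarrow> 'm) \<Rightarrow> 'r set \<Rightarrow> (rat \<Rightarrow> 'm set) \<Rightarrow> bool" where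
  "is_V_filtration p scale k \<aa> V \<longleftrightarrow>
     principal_cartier_module p scale k \<and>
     (\<forall>t. module.subspace scale (V t)) \<and>
     antimono V \<and>
     (\<forall>t. \<exists>\<delta>>0. \<forall>\<epsilon>. 0 < \<epsilon> \<and> \<epsilon> < \<delta> \<longrightarrow> V (t + \<epsilon>) = V t) \<and>
     (\<Union>t. V t) = UNIV \<and>
     fin_gen scale (V 0) \<and>
     (\<exists>\<delta>>0. \<forall>s. \<bar>s\<bar> < \<delta> \<longrightarrow> V s = V 0) \<and>
     (\<exists>x\<in>\<aa>. x \<noteq> 0 \<and> (\<forall>t. \<forall>j::nat.
        scale (x ^ j) ` V t \<subseteq> V (t + of_nat j) \<and> inj_on (scale (x ^ j)) (V t))) \<and>
     (\<forall>X. finite X \<and> module.span (*) X = \<aa> \<longrightarrow>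
        (\<forall>t > of_nat (card X). V t = ideal_times scale \<aa> (V (t - 1)))) \<and>
     (\<forall>t. k ` V (t * of_nat p) = V t)"

end

theory Submission
  imports Defs
begin

text \<open>
  Let \<open>k\<close> be the map by which \<open>\<kappa>\<close> acts on \<open>M\<close>; it is additive, satisfies \<open>k(r\<^sup>pm) = r k(m)\<close>, and is surjective
  because \<open>M\<close> is F-pure.  The filtration is

    \<open>V\<^sup>t = \<Union>\<^sub>n k\<^sup>n(\<aa>\<^bsup>\<lceil>tp\<^sup>n\<rceil>\<^esup>M)\<close>,

  the formula familiar from test ideals of regular rings.  The union is increasing, because
  \<open>\<aa>\<^sup>jM = \<aa>\<^sup>jk(M) \<subseteq> k(\<aa>\<^bsup>jp\<^esup>M)\<close>; as \<open>M\<close> is noetherian, \<open>V\<^sup>t\<close> is one of its members.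

  Everything rests on one consequence of F-regularity (\<open>strongly_F_regular\<close>): if an ideal \<open>J\<close> is contained in
  no generic point of \<open>Supp M\<close>, then \<open>k\<^sup>e(JM) = M\<close> for some \<open>e\<close>.  Indeed the submodules \<open>k\<^sup>e(JM)\<close> increase, and
  their union is a Cartier submodule agreeing with \<open>M\<close> generically.  Replacing \<open>M\<close> by \<open>k\<^sup>e(JM)\<close> in the formula for
  \<open>V\<^sup>t\<close> inserts a factor \<open>J\<close>:

    \<open>k\<^sup>n(\<aa>\<^sup>jM) \<subseteq> k\<^bsup>n+e\<^esup>(\<aa>\<^bsup>jp\<^sup>e\<^esup>JM)\<close>.

  For \<open>J = (x)\<close> with an \<open>M\<close>-regular element \<open>x \<in> \<aa>\<close>, the factor raises the exponent of \<open>\<aa>\<close> by one, whence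
  right-continuity (\<open>V_right_continuous\<close>).  For \<open>J = (N : M)\<close>, where \<open>N\<close> is a submodule over the algebra twisted by
  \<open>\<aa>\<^sup>t\<close> that agrees with \<open>M\<close> generically, the right-hand side lies in \<open>N\<close>, whence \<open>V\<^sup>t\<close> is the smallest such
  submodule (\<open>V_minimal\<close>).  The Skoda property (\<open>V_skoda\<close>) comes from the inclusion \<open>\<aa>\<^sup>m \<subseteq> \<aa>\<^bsup>[q]\<^esup>\<aa>\<^bsup>m-q\<^esup>\<close>, valid for
  \<open>m > n(q - 1)\<close> if \<open>\<aa>\<close> has \<open>n\<close> generators, applied with \<open>q = p\<^sup>e\<close>.  The remaining properties are computations with
  exponents.

  The definition of the test module compares with the stable image of \<open>M\<close> under the twisted algebra instead of
  with \<open>M\<close>.  That the images \<open>(\<C>\<^sub>+)\<^sup>eM\<close> do stabilize is proved by Gabber's argument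
  (\<open>contracting_iterates_stabilize\<close>): the ideals \<open>((\<C>\<^sub>+)\<^bsup>e+1\<^esup>M : (\<C>\<^sub>+)\<^sup>eM)\<close> increase, and their union cannot be
  proper, because at a minimal prime over it the relevant quotient of \<open>M\<close> is artinian.  Each of these images
  contains \<open>x\<^sup>jM\<close> for some \<open>j\<close>, and \<open>x\<close> lies in no generic point of \<open>Supp M\<close>; so the stable image and \<open>M\<close> have the
  same generic points and agree there.
\<close>

section \<open>Noetherian modules\<close>

lemma module_mult: "module ((*) :: 'r::comm_ring_1 \<Rightarrow> 'r \<Rightarrow> 'r)"
  by standard (simp_all add: algebra_simps)

text \<open>
  Hilbert's induction on the number of generators: the coefficients at the new generator \<open>x\<close> of the elements
  of \<open>N\<close> form an ideal.  Lifts to \<open>N\<close> of finitely many generators of this ideal, together with generators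
  of the part of \<open>N\<close> that does not involve \<open>x\<close>, generate \<open>N\<close>.
\<close>

lemma (in module) fin_gen_subspace_of_span:
  assumes noeth: "noetherian TYPE('a)" and "finite X" "subspace N" "N \<subseteq> span X"
  shows "fin_gen scale N"
  using assms(2-)
proof (induction X arbitrary: N rule: finite_induct)
  case empty
  then have "N = {0}" using subspace_0 by auto
  then show ?case unfolding fin_gen_def by (intro exI[of _ "{}"]) auto
next
  case (insert x X)
  define I where "I = {r. \<exists>n\<in>N. n - r *s x \<in> span X}"
  have "module.subspace (*) I"
  proof (rule module.subspaceI[OF module_mult])
    show "0 \<in> I" using subspace_0[OF insert.prems(1)] span_zero[of X] by (force simp: I_def)
  next
    fix r s assume "r \<in> I" "s \<in> I"
    then obtain m n where "m \<in> N" "m - r *s x \<in> span X" "n \<in> N" "n - s *s x \<in> span X"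
      by (auto simp: I_def)
    moreover from this have "(m + n) - (r + s) *s x \<in> span X"
      using span_add[of "m - r *s x" X "n - s *s x"] by (simp add: algebra_simps)
    ultimately show "r + s \<in> I" using subspace_add[OF insert.prems(1)] by (auto simp: I_def)
  next
    fix c r assume "r \<in> I"
    then obtain m where "m \<in> N" "m - r *s x \<in> span X" by (auto simp: I_def)
    moreover from this have "c *s m - (c * r) *s x \<in> span X"
      using span_scale[of "m - r *s x" X c] by (simp add: algebra_simps)
    ultimately show "c * r \<in> I" using subspace_scale[OF insert.prems(1)] by (auto simp: I_def)
  qed
  then obtain Y where Y: "finite Y" "module.span (*) Y = I"
    using noeth by (auto simp: noetherian_def)
  have "\<forall>y\<in>Y. \<exists>n. n \<in> N \<and> n - y *s x \<in> span X"
    using module.span_base[OF module_mult, of _ Y] Y(2) by (auto simp: I_def)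
  then obtain g where g: "\<And>y. y \<in> Y \<Longrightarrow> g y \<in> N \<and> g y - y *s x \<in> span X" by metis
  have "fin_gen scale (N \<inter> span X)"
    using insert.prems insert.IH[of "N \<inter> span X"] subspace_inter by auto
  then obtain Z where Z: "finite Z" "span Z = N \<inter> span X" by (auto simp: fin_gen_def)
  have lift: "\<exists>m\<in>span (g ` Y). m - r *s x \<in> span X" if "r \<in> module.span (*) Y" for r
    using that
  proof (induction rule: module.span_induct_alt[OF module_mult, consumes 1, case_names base step])
    case base
    then show ?case using span_zero by force
  next
    case (step c y r)
    then obtain m where "m \<in> span (g ` Y)" "m - r *s x \<in> span X" by auto
    moreover have "c *s (g y - y *s x) + (m - r *s x) \<in> span X"
      using calculation g[OF step(1)] by (intro span_add span_scale) auto
    moreover have "c *s g y + m \<in> span (g ` Y)"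
      using calculation(1) span_scale[OF span_base[of "g y" "g ` Y"]] step(1) by (intro span_add) auto
    ultimately show ?case by (intro bexI[of _ "c *s g y + m"]) (auto simp: algebra_simps)
  qed
  have gN: "span (g ` Y) \<subseteq> N" using g insert.prems by (intro span_minimal) auto
  have "span (g ` Y \<union> Z) = N"
  proof
    have "Z \<subseteq> N" using Z(2) span_superset[of Z] by auto
    then show "span (g ` Y \<union> Z) \<subseteq> N" using g insert.prems by (intro span_minimal) auto
    show "N \<subseteq> span (g ` Y \<union> Z)"
    proof
      fix n assume n: "n \<in> N"
      then obtain r where r: "n - r *s x \<in> span X"
        using insert.prems span_breakdown_eq by blast
      with n have "r \<in> I" by (auto simp: I_def)
      then obtain m where m: "m \<in> span (g ` Y)" "m - r *s x \<in> span X"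
        using lift Y by auto
      have "n - m \<in> span X" using span_diff[OF r m(2)] by simp
      moreover have "n - m \<in> N" using n m gN subspace_diff[OF insert.prems(1)] by auto
      ultimately have "n - m \<in> span (g ` Y \<union> Z)" using Z(2) span_mono[of Z "g ` Y \<union> Z"] by auto
      moreover have "m \<in> span (g ` Y \<union> Z)" using m(1) span_mono[of "g ` Y" "g ` Y \<union> Z"] by auto
      ultimately show "n \<in> span (g ` Y \<union> Z)" using span_add[of "n - m" _ m] by simp
    qed
  qed
  then show ?case using Y(1) Z(1) unfolding fin_gen_def by (intro exI[of _ "g ` Y \<union> Z"]) auto
qed

locale noetherian_module = module scale
  for scale :: "'r::comm_ring_1 \<Rightarrow> 'm::ab_group_add \<Rightarrow> 'm" (infixr \<open>*s\<close> 75) +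
  assumes noetherian_ring: "noetherian TYPE('r)"
    and fin_gen_UNIV: "fin_gen scale UNIV"
begin

lemma Union_chain_eq_member:
  assumes sub: "\<And>n::nat. subspace (N n)" and inc: "incseq N"
  shows "\<exists>n. (\<Union>i. N i) = N n"
proof -
  have "subspace (\<Union>i. N i)"
  proof (rule subspaceI)
    show "0 \<in> (\<Union>i. N i)" using subspace_0[OF sub] by auto
    show "x + y \<in> (\<Union>i. N i)" if xy: "x \<in> (\<Union>i. N i)" "y \<in> (\<Union>i. N i)" for x y
    proof -
      from xy obtain i j where "x \<in> N i" "y \<in> N j" by auto
      then have "x \<in> N (max i j)" "y \<in> N (max i j)"
        using incseqD[OF inc, of i "max i j"] incseqD[OF inc, of j "max i j"] by auto
      then show ?thesis using subspace_add[OF sub] by auto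
    qed
    show "c *s x \<in> (\<Union>i. N i)" if "x \<in> (\<Union>i. N i)" for c x
      using that subspace_scale[OF sub] by auto
  qed
  moreover obtain X0 where "finite X0" "span X0 = UNIV"
    using fin_gen_UNIV by (auto simp: fin_gen_def)
  ultimately obtain X where X: "finite X" "span X = (\<Union>i. N i)"
    using fin_gen_subspace_of_span[OF noetherian_ring, of X0 "\<Union>i. N i"] by (auto simp: fin_gen_def)
  then have "\<forall>x\<in>X. \<exists>i. x \<in> N i" using span_superset[of X] by auto
  then obtain i where i: "\<And>x. x \<in> X \<Longrightarrow> x \<in> N (i x)" by metis
  define n where "n = Max (insert 0 (i ` X))"
  have "X \<subseteq> N n"
  proof
    fix x assume "x \<in> X"
    then have "i x \<le> n" using X(1) by (auto simp: n_def)
    then show "x \<in> N n" using incseqD[OF inc] i[OF \<open>x \<in> X\<close>] by blast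
  qed
  then have "(\<Union>i. N i) \<subseteq> N n" using X(2) span_minimal[OF _ sub] by metis
  then show ?thesis by (intro exI[of _ n]) auto
qed

lemma maximal_subspace_exists:
  assumes "F \<noteq> {}" and sub: "\<And>N. N \<in> F \<Longrightarrow> subspace N"
  shows "\<exists>N\<in>F. \<forall>N'\<in>F. N \<subseteq> N' \<longrightarrow> N' = N"
proof (rule ccontr)
  assume "\<not> ?thesis"
  then have "\<exists>N'. N' \<in> F \<and> N \<subset> N'" if "N \<in> F" for N using that by blast
  then obtain f where f: "\<And>n::nat. f n \<in> F \<and> f n \<subset> f (Suc n)"
    using dependent_nat_choice[of "\<lambda>_ N. N \<in> F" "\<lambda>_ N N'. N \<subset> N'"] assms(1) by auto
  have "incseq f" using f by (intro incseq_SucI) auto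
  then obtain n where "(\<Union>i. f i) = f n" using Union_chain_eq_member[of f] f sub by auto
  then have "f (Suc n) \<subseteq> f n" by auto
  then show False using f[of n] by auto
qed

end

lemma noetherian_module_mult:
  assumes "noetherian TYPE('r::comm_ring_1)"
  shows "noetherian_module ((*) :: 'r \<Rightarrow> 'r \<Rightarrow> 'r)"
proof -
  interpret ideals: module "(*) :: 'r \<Rightarrow> 'r \<Rightarrow> 'r" by (rule module_mult)
  have "ideals.span {1} = UNIV" by (auto simp: ideals.span_singleton)
  then show ?thesis
    using assms by unfold_locales (auto simp: fin_gen_def intro!: exI[of _ "{1}"])
qed

section \<open>Prime ideals\<close>

abbreviation ideal :: "'r::comm_ring_1 set \<Rightarrow> bool" where
  "ideal \<equiv> module.subspace (*)"

lemmas ideal_iff = module.subspace_def[OF module_mult]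

lemma prime_ideal_one_notin: "prime_ideal P \<Longrightarrow> 1 \<notin> P"
  unfolding prime_ideal_def ideal_iff by (metis UNIV_eq_I mult.right_neutral)

lemma prime_ideal_mult_notin: "prime_ideal P \<Longrightarrow> x \<notin> P \<Longrightarrow> y \<notin> P \<Longrightarrow> x * y \<notin> P"
  by (auto simp: prime_ideal_def)

text \<open>
  An ideal that is maximal among those containing \<open>I\<close> and missing \<open>S\<close> is prime.
\<close>

lemma prime_ideal_avoiding_exists:
  fixes I S :: "'r::comm_ring_1 set"
  assumes noeth: "noetherian TYPE('r)" and I: "ideal I"
    and S: "1 \<in> S" "\<And>x y. x \<in> S \<Longrightarrow> y \<in> S \<Longrightarrow> x * y \<in> S" "I \<inter> S = {}"
  shows "\<exists>P. prime_ideal P \<and> I \<subseteq> P \<and> P \<inter> S = {}"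
proof -
  \<comment> \<open>proved first, since the interpretation below makes the simplifier reassociate products to the left\<close>
  have expand: "(a + r * x) * (b + s * y) = (b + s * y) * a + ((r * x) * b + (r * s) * (x * y))"
    for a r x b s y :: 'r
    by (simp add: algebra_simps)
  interpret ideals: noetherian_module "(*) :: 'r \<Rightarrow> 'r \<Rightarrow> 'r"
    by (rule noetherian_module_mult[OF noeth])
  define F where "F = {J. ideal J \<and> I \<subseteq> J \<and> J \<inter> S = {}}"
  have "\<exists>P\<in>F. \<forall>J\<in>F. P \<subseteq> J \<longrightarrow> J = P"
    by (rule ideals.maximal_subspace_exists) (use I S in \<open>auto simp: F_def\<close>)
  then obtain P where P: "ideal P" "I \<subseteq> P" "P \<inter> S = {}" and max: "\<And>J. J \<in> F \<Longrightarrow> P \<subseteq> J \<Longrightarrow> J = P"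
    by (auto simp: F_def)
  have meets: "\<exists>a\<in>P. \<exists>r. a + r * x \<in> S" if "x \<notin> P" for x
  proof (rule ccontr)
    assume no: "\<not> ?thesis"
    define J where "J = ideals.span (insert x P)"
    have "P \<subseteq> J" "x \<in> J" using ideals.span_superset[of "insert x P"] by (auto simp: J_def)
    moreover have "J \<inter> S = {}"
    proof -
      have False if "y \<in> J" "y \<in> S" for y
      proof -
        from that(1) obtain r where "y - r * x \<in> P"
          using ideals.span_eq_iff[THEN iffD2, OF P(1)] unfolding J_def ideals.span_breakdown_eq by auto
        moreover have "(y - r * x) + r * x \<in> S" using that by simp
        ultimately show False using no by blast
      qed
      then show ?thesis by auto
    qed
    ultimately have "J \<in> F" using P(2) by (auto simp: F_def J_def)
    then show False using max[of J] \<open>P \<subseteq> J\<close> \<open>x \<in> J\<close> that by auto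
  qed
  have "prime_ideal P"
    unfolding prime_ideal_def
  proof (intro conjI allI impI)
    show "P \<noteq> UNIV" using P(3) S(1) by auto
  next
    fix x y assume xy: "x * y \<in> P"
    show "x \<in> P \<or> y \<in> P"
    proof (rule ccontr)
      assume "\<not> ?thesis"
      then have "x \<notin> P" "y \<notin> P" by auto
      then obtain a r b s where "a \<in> P" "a + r * x \<in> S" "b \<in> P" "b + s * y \<in> S"
        using meets[of x] meets[of y] by metis
      moreover note expand[of a r x b s y]
      moreover have "(b + s * y) * a + ((r * x) * b + (r * s) * (x * y)) \<in> P"
        using \<open>a \<in> P\<close> \<open>b \<in> P\<close> xy P(1) unfolding ideal_iff by blast
      ultimately show False
        using S(2)[of "a + r * x" "b + s * y"] P(3) by auto
    qed
  qed (use P in auto)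
  then show ?thesis using P by auto
qed

definition minimal_prime_over :: "'r::comm_ring_1 set \<Rightarrow> 'r set \<Rightarrow> bool" where
  "minimal_prime_over I P \<longleftrightarrow> prime_ideal P \<and> I \<subseteq> P \<and>
     (\<forall>Q. prime_ideal Q \<and> I \<subseteq> Q \<and> Q \<subseteq> P \<longrightarrow> Q = P)"

text \<open>
  The complements of the primes over \<open>I\<close> are closed under unions of chains, so Zorn's lemma applies to them.
\<close>

lemma minimal_prime_below:
  assumes P0: "prime_ideal P0" "I \<subseteq> P0"
  shows "\<exists>P. minimal_prime_over I P"
proof -
  define A where "A = {- P |P. prime_ideal P \<and> I \<subseteq> P}"
  have chain: "\<Union>\<C> \<in> A" if ne: "\<C> \<noteq> {}" and ch: "subset.chain A \<C>" for \<C>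
  proof -
    define Q where "Q = - \<Union>\<C>"
    have mem: "prime_ideal (- B)" "I \<subseteq> - B" if "B \<in> \<C>" for B
      using that ch by (auto simp: A_def subset.chain_def)
    have closed: "0 \<notin> B" "\<And>x y. x \<notin> B \<Longrightarrow> y \<notin> B \<Longrightarrow> x + y \<notin> B"
      "\<And>c x. x \<notin> B \<Longrightarrow> c * x \<notin> B" if "B \<in> \<C>" for B
    proof -
      have "ideal (- B)" using mem(1)[OF that] by (simp add: prime_ideal_def)
      then show "0 \<notin> B" "\<And>x y. x \<notin> B \<Longrightarrow> y \<notin> B \<Longrightarrow> x + y \<notin> B"
        "\<And>c x. x \<notin> B \<Longrightarrow> c * x \<notin> B"
        unfolding ideal_iff Ball_def Compl_iff by blast+
    qed
    have "prime_ideal Q"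
      unfolding prime_ideal_def ideal_iff
    proof (intro conjI allI impI ballI)
      show "0 \<in> Q" "\<And>x y. x \<in> Q \<Longrightarrow> y \<in> Q \<Longrightarrow> x + y \<in> Q" "\<And>c x. x \<in> Q \<Longrightarrow> c * x \<in> Q"
        using closed by (auto simp: Q_def)
      show "Q \<noteq> UNIV" using ne mem(1) prime_ideal_one_notin by (force simp: Q_def)
      fix x y assume xy: "x * y \<in> Q"
      show "x \<in> Q \<or> y \<in> Q"
      proof (rule ccontr)
        assume "\<not> ?thesis"
        then obtain B B' where B: "B \<in> \<C>" "x \<in> B" "B' \<in> \<C>" "y \<in> B'" by (auto simp: Q_def)
        then have "B \<subseteq> B' \<or> B' \<subseteq> B" using ch by (auto simp: subset.chain_def)
        then obtain B'' where "B'' \<in> \<C>" "x \<in> B''" "y \<in> B''" using B by auto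
        then show False using mem(1)[of B''] xy by (auto simp: prime_ideal_def Q_def)
      qed
    qed
    moreover have "I \<subseteq> Q" using mem(2) by (auto simp: Q_def)
    ultimately show ?thesis by (auto simp: A_def Q_def intro!: exI[of _ "- \<Union>\<C>"])
  qed
  have "A \<noteq> {}" using P0 by (auto simp: A_def)
  then obtain B where B: "B \<in> A" "\<And>X. X \<in> A \<Longrightarrow> B \<subseteq> X \<Longrightarrow> X = B"
    using subset_Zorn_nonempty[OF _ chain] by blast
  then obtain P where P: "prime_ideal P" "I \<subseteq> P" "B = - P" by (auto simp: A_def)
  have "Q = P" if "prime_ideal Q" "I \<subseteq> Q" "Q \<subseteq> P" for Q
    using B(2)[of "- Q"] that P(3) by (auto simp: A_def)
  then show ?thesis using P by (auto simp: minimal_prime_over_def)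
qed

lemma minimal_prime_over_exists:
  fixes I :: "'r::comm_ring_1 set"
  assumes "noetherian TYPE('r)" "ideal I" "1 \<notin> I"
  shows "\<exists>P. minimal_prime_over I P"
  using prime_ideal_avoiding_exists[OF assms(1,2), of "{1}"] assms(3) minimal_prime_below by auto

text \<open>
  Locally at a minimal prime \<open>P\<close> over \<open>I\<close> the only prime over \<open>I\<close> is \<open>P\<close>, so every element of \<open>P\<close> is
  nilpotent modulo \<open>I\<close> there.  Without localizing: a prime over \<open>I\<close> missing all products \<open>ux\<^sup>n\<close> with
  \<open>u \<notin> P\<close> would be contained in \<open>P\<close> and miss \<open>x\<close>.
\<close>

lemma minimal_prime_over_locally_nilpotent:
  fixes I :: "'r::comm_ring_1 set"
  assumes noeth: "noetherian TYPE('r)" and I: "ideal I"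
    and P: "minimal_prime_over I P" and x: "x \<in> P"
  shows "\<exists>u n. u \<notin> P \<and> u * x ^ n \<in> I"
proof (rule ccontr)
  assume no: "\<not> ?thesis"
  have prime: "prime_ideal P" using P by (auto simp: minimal_prime_over_def)
  define S where "S = {u * x ^ n |u n. u \<notin> P}"
  have "s * t \<in> S" if st: "s \<in> S" "t \<in> S" for s t
  proof -
    from st obtain u n v m where "s = u * x ^ n" "t = v * x ^ m" "u \<notin> P" "v \<notin> P" by (auto simp: S_def)
    then have "s * t = (u * v) * x ^ (n + m)" "u * v \<notin> P"
      by (simp_all add: power_add mult_ac prime_ideal_mult_notin[OF prime])
    then show ?thesis by (auto simp: S_def)
  qed
  moreover have in_S: "u \<in> S" if "u \<notin> P" for u
  proof -
    have "u = u * x ^ 0" by simp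
    then show ?thesis using that unfolding S_def by blast
  qed
  moreover have "1 \<in> S" using in_S prime_ideal_one_notin[OF prime] by auto
  moreover have "I \<inter> S = {}" using no by (auto simp: S_def)
  ultimately obtain Q where Q: "prime_ideal Q" "I \<subseteq> Q" "Q \<inter> S = {}"
    using prime_ideal_avoiding_exists[OF noeth I, of S] by blast
  have "Q \<subseteq> P" using Q(3) in_S by auto
  then have "Q = P" using P Q by (auto simp: minimal_prime_over_def)
  moreover have "x \<in> S"
  proof -
    have "x = 1 * x ^ 1" by simp
    then show ?thesis using prime_ideal_one_notin[OF prime] unfolding S_def by blast
  qed
  ultimately show False using Q(3) x by auto
qed

section \<open>Localization and generic points\<close>

definition annihilator :: "('r::comm_ring_1 \<Rightarrow> 'm::ab_group_add \<Rightarrow> 'm) \<Rightarrow> 'r set" where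
  "annihilator scale = {r. \<forall>m. scale r m = 0}"

context module
begin

text \<open>
  Localized submodules are handled through two rules: equality at \<open>P\<close> allows clearing denominators
  (here), and a submodule that absorbs a multiplier outside \<open>P\<close> is everything at \<open>P\<close> (\<open>localized_eq_UNIV\<close>).
\<close>

lemma localized_memD:
  assumes P: "prime_ideal P" and N: "subspace N" and eq: "localized scale P N = localized scale P N'"
    and m: "m \<in> N'"
  shows "\<exists>u. u \<notin> P \<and> u *s m \<in> N"
proof -
  have one: "1 \<notin> P" by (rule prime_ideal_one_notin[OF P])
  then have "frac_rel scale P `` {(m, 1)} \<in> localized scale P N"
    unfolding eq using m by (auto simp: localized_def)
  then obtain n s where ns: "n \<in> N" "s \<notin> P" "frac_rel scale P `` {(m, 1)} = frac_rel scale P `` {(n, s)}"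
    by (auto simp: localized_def)
  have "(n, s) \<in> frac_rel scale P `` {(n, s)}"
    using ns one by (auto simp: frac_rel_def)
  then have "(n, s) \<in> frac_rel scale P `` {(m, 1)}" using ns by simp
  then obtain u where u: "u \<notin> P" "(u * s) *s m = u *s n" by (auto simp: frac_rel_def)
  then have "u * s \<notin> P" "(u * s) *s m \<in> N"
    using ns prime_ideal_mult_notin[OF P] subspace_scale[OF N] by auto
  then show ?thesis by blast
qed

lemma frac_rel_cancel:
  assumes P: "prime_ideal P" and x: "x \<notin> P" and s: "s \<notin> P"
  shows "frac_rel scale P `` {(x *s m, x * s)} = frac_rel scale P `` {(m, s)}"
proof -
  have xs: "x * s \<notin> P" using prime_ideal_mult_notin[OF P x s] .
  have "(\<exists>u. u \<notin> P \<and> (u * t) *s (x *s m) = (u * (x * s)) *s n) \<longleftrightarrow>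
        (\<exists>u. u \<notin> P \<and> (u * t) *s m = (u * s) *s n)" for t n
  proof
    assume "\<exists>u. u \<notin> P \<and> (u * t) *s (x *s m) = (u * (x * s)) *s n"
    then obtain u where "u \<notin> P" "(u * t) *s (x *s m) = (u * (x * s)) *s n" by blast
    then have "u * x \<notin> P" "((u * x) * t) *s m = ((u * x) * s) *s n"
      using prime_ideal_mult_notin[OF P _ x] by (simp_all add: mult_ac)
    then show "\<exists>u. u \<notin> P \<and> (u * t) *s m = (u * s) *s n" by blast
  next
    assume "\<exists>u. u \<notin> P \<and> (u * t) *s m = (u * s) *s n"
    then obtain u where u: "u \<notin> P" "(u * t) *s m = (u * s) *s n" by blast
    then have "x *s ((u * t) *s m) = x *s ((u * s) *s n)" by simp
    then have "(u * t) *s (x *s m) = (u * (x * s)) *s n" by (simp add: mult_ac)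
    with u show "\<exists>u. u \<notin> P \<and> (u * t) *s (x *s m) = (u * (x * s)) *s n" by blast
  qed
  then show ?thesis using s xs by (auto simp: frac_rel_def)
qed

lemma localized_eq_UNIV:
  assumes P: "prime_ideal P" and x: "x \<notin> P" and N: "\<And>m. x *s m \<in> N"
  shows "localized scale P N = localized scale P UNIV"
proof
  show "localized scale P UNIV \<subseteq> localized scale P N"
  proof
    fix c assume "c \<in> localized scale P UNIV"
    then obtain m s where "c = frac_rel scale P `` {(m, s)}" "s \<notin> P"
      by (auto simp: localized_def)
    then have "c = frac_rel scale P `` {(x *s m, x * s)}" "x * s \<notin> P"
      using frac_rel_cancel[OF P x] prime_ideal_mult_notin[OF P x] by auto
    then show "c \<in> localized scale P N" using N unfolding localized_def by blast
  qed
qed (auto simp: localized_def)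

lemma supp_iff:
  assumes N: "subspace N"
  shows "P \<in> supp scale N \<longleftrightarrow> prime_ideal P \<and> (\<exists>m\<in>N. \<forall>u. u \<notin> P \<longrightarrow> u *s m \<noteq> 0)"
proof -
  have "localized scale P N = localized scale P {0} \<longleftrightarrow> (\<forall>m\<in>N. \<exists>u. u \<notin> P \<and> u *s m = 0)"
    if P: "prime_ideal P"
  proof
    assume "localized scale P N = localized scale P {0}"
    then show "\<forall>m\<in>N. \<exists>u. u \<notin> P \<and> u *s m = 0"
      using localized_memD[OF P subspace_single_0, of N] by auto
  next
    assume kill: "\<forall>m\<in>N. \<exists>u. u \<notin> P \<and> u *s m = 0"
    show "localized scale P N = localized scale P {0}"
    proof
      show "localized scale P {0} \<subseteq> localized scale P N"
        using subspace_0[OF N] by (auto simp: localized_def)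
      show "localized scale P N \<subseteq> localized scale P {0}"
      proof
        fix c assume "c \<in> localized scale P N"
        then obtain m s where c: "c = frac_rel scale P `` {(m, s)}" "s \<notin> P" "m \<in> N"
          by (auto simp: localized_def)
        then obtain u where u: "u \<notin> P" "u *s m = 0" using kill by auto
        then have "c = frac_rel scale P `` {(0, u * s)}" "u * s \<notin> P"
          using frac_rel_cancel[OF P u(1) c(2), of m] prime_ideal_mult_notin[OF P u(1) c(2)] c by auto
        then show "c \<in> localized scale P {0}" unfolding localized_def by blast
      qed
    qed
  qed
  then show ?thesis by (auto simp: supp_def)
qed

lemma ideal_colon:
  assumes B: "subspace B"
  shows "ideal {r. \<forall>m\<in>A. r *s m \<in> B}"
  unfolding ideal_iff
proof (intro conjI ballI allI)
  fix c r assume "r \<in> {r. \<forall>m\<in>A. r *s m \<in> B}"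
  then have "c *s (r *s m) \<in> B" if "m \<in> A" for m using that subspace_scale[OF B] by blast
  then show "c * r \<in> {r. \<forall>m\<in>A. r *s m \<in> B}" by simp
qed (simp_all add: scale_left_distrib subspace_0[OF B] subspace_add[OF B])

lemma ideal_annihilator: "ideal (annihilator scale)"
  using ideal_colon[OF subspace_single_0, of UNIV] by (simp add: annihilator_def)

text \<open>
  For a finitely generated module one common denominator works for all elements, because finitely many
  suffice for the generators and their product stays outside the prime \<open>P\<close>.
\<close>

lemma uniform_denominator:
  assumes P: "prime_ideal P" and N: "subspace N" and fg: "fin_gen scale UNIV"
    and loc: "\<And>m. \<exists>u. u \<notin> P \<and> u *s m \<in> N"
  shows "\<exists>u. u \<notin> P \<and> (\<forall>m. u *s m \<in> N)"
proof -
  obtain X where X: "finite X" "span X = UNIV" using fg by (auto simp: fin_gen_def)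
  have "\<exists>u. u \<notin> P \<and> (\<forall>m\<in>X. u *s m \<in> N)"
    using X(1)
  proof (induction X)
    case empty
    then show ?case using prime_ideal_one_notin[OF P] by auto
  next
    case (insert x X)
    then obtain u v where uv: "u \<notin> P" "\<forall>m\<in>X. u *s m \<in> N" "v \<notin> P" "v *s x \<in> N"
      using loc[of x] by blast
    then have "(v * u) *s m \<in> N" if "m \<in> insert x X" for m
      using that subspace_scale[OF N, of "u *s m" v] subspace_scale[OF N, of "v *s x" u]
      by (auto simp: mult.commute)
    then show ?case using uv prime_ideal_mult_notin[OF P] by blast
  qed
  then obtain u where u: "u \<notin> P" "\<forall>m\<in>X. u *s m \<in> N" by blast
  have "subspace {m. u *s m \<in> N}"
    using N by (intro subspaceI)
      (auto simp: scale_right_distrib subspace_0 subspace_add scale_left_commute[of u] subspace_scale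
        simp del: scale_scale)
  then have "span X \<subseteq> {m. u *s m \<in> N}" using u by (intro span_minimal) auto
  then show ?thesis using u X by auto
qed

end

context noetherian_module
begin

text \<open>
  The support of a finitely generated module is the closed set defined by its annihilator, so its
  generic points are the minimal primes of the annihilator.
\<close>

lemma supp_UNIV_iff: "P \<in> supp scale UNIV \<longleftrightarrow> prime_ideal P \<and> annihilator scale \<subseteq> P"
proof -
  have "annihilator scale \<subseteq> P" if P: "P \<in> supp scale UNIV"
    using P unfolding supp_iff[OF subspace_UNIV] by (auto simp: annihilator_def)
  moreover have "P \<in> supp scale UNIV" if P: "prime_ideal P" "annihilator scale \<subseteq> P"
  proof (rule ccontr)
    assume "P \<notin> supp scale UNIV"
    then have "\<exists>u. u \<notin> P \<and> u *s m \<in> {0}" for m using P by (auto simp: supp_iff)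
    then obtain u where "u \<notin> P" "\<forall>m. u *s m \<in> {0}"
      using uniform_denominator[OF P(1) subspace_single_0 fin_gen_UNIV] by blast
    then show False using P by (auto simp: annihilator_def)
  qed
  ultimately show ?thesis by (auto simp: supp_def)
qed

lemma generic_points_UNIV: "generic_points scale UNIV = {P. minimal_prime_over (annihilator scale) P}"
  unfolding generic_points_def minimal_prime_over_def Ball_def supp_UNIV_iff by blast

lemma generic_point_exists:
  assumes "(UNIV :: 'm set) \<noteq> {0}"
  shows "\<exists>P. P \<in> generic_points scale UNIV"
proof -
  obtain m :: 'm where "m \<noteq> 0" using assms by auto
  then have "1 \<notin> annihilator scale" by (auto simp: annihilator_def)
  then show ?thesis
    using minimal_prime_over_exists[OF noetherian_ring ideal_annihilator]
    by (auto simp: generic_points_UNIV)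
qed

lemma regular_power:
  assumes "\<And>m. x *s m = 0 \<Longrightarrow> m = 0" and "x ^ n *s m = 0"
  shows "m = 0"
  using assms(2)
proof (induction n)
  case (Suc n)
  then have "x *s (x ^ n *s m) = 0" by simp
  then have "x ^ n *s m = 0" by (rule assms(1))
  then show ?case by (rule Suc.IH)
qed simp

text \<open>
  A generic point \<open>P\<close> is a minimal prime of the annihilator, so \<open>x \<in> P\<close> would give \<open>ux\<^sup>nM = 0\<close> with \<open>u \<notin> P\<close>;
  for \<open>M\<close>-regular \<open>x\<close> this forces \<open>uM = 0\<close>, contradicting \<open>P \<in> Supp M\<close>.
\<close>

lemma regular_notin_generic_point:
  assumes x: "\<And>m. x *s m = 0 \<Longrightarrow> m = 0" and P: "P \<in> generic_points scale UNIV"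
  shows "x \<notin> P"
proof
  assume "x \<in> P"
  then obtain u n where u: "u \<notin> P" "u * x ^ n \<in> annihilator scale"
    using minimal_prime_over_locally_nilpotent[OF noetherian_ring ideal_annihilator _ \<open>x \<in> P\<close>] P
    unfolding generic_points_UNIV by blast
  have "u *s m = 0" for m
  proof (rule regular_power[OF x])
    show "x ^ n *s (u *s m) = 0" using u(2) by (auto simp: annihilator_def mult.commute)
  qed
  then have "u \<in> annihilator scale" by (auto simp: annihilator_def)
  then show False using P u by (auto simp: generic_points_UNIV minimal_prime_over_def)
qed

text \<open>
  If \<open>x\<close> is \<open>M\<close>-regular, then a submodule containing \<open>xM\<close> contains an isomorphic copy of \<open>M\<close>.
\<close>

lemma supp_eq_UNIV:
  assumes x: "\<And>m. x *s m = 0 \<Longrightarrow> m = 0" and N: "subspace N" "\<And>m. x *s m \<in> N"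
  shows "supp scale N = supp scale UNIV"
proof (intro set_eqI iffI)
  fix P assume "P \<in> supp scale UNIV"
  then obtain m where P: "prime_ideal P" and m: "\<And>u. u \<notin> P \<Longrightarrow> u *s m \<noteq> 0"
    unfolding supp_iff[OF subspace_UNIV] by blast
  have "u *s (x *s m) \<noteq> 0" if "u \<notin> P" for u
    using x[of "u *s m"] m[OF that] unfolding scale_left_commute[of u x m] by blast
  then show "P \<in> supp scale N" using P N(2)[of m] unfolding supp_iff[OF N(1)] by blast
qed (use N in \<open>auto simp: supp_iff\<close>)

end

section \<open>Stabilization of iterated images\<close>

text \<open>
  The descending chain condition for the localization of \<open>A/L\<close> at \<open>P\<close>.  The submodules in a chain are
  finitely generated in the intended use, so that equality of two successive members at \<open>P\<close> amounts to a
  single multiplier \<open>s \<notin> P\<close> carrying one into the other.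
\<close>

definition (in module) locally_artinian :: "'a set \<Rightarrow> 'b set \<Rightarrow> 'b set \<Rightarrow> bool" where
  "locally_artinian P L A \<longleftrightarrow>
     (\<forall>U::nat \<Rightarrow> 'b set. (\<forall>e. subspace (U e) \<and> L \<subseteq> U e \<and> U e \<subseteq> A) \<and> decseq U \<longrightarrow>
        (\<exists>e0. \<forall>e\<ge>e0. \<exists>s. s \<notin> P \<and> (\<forall>m\<in>U e. s *s m \<in> U (Suc e))))"

context module
begin

lemma locally_artinianD:
  assumes "locally_artinian P L A" "\<And>e. subspace (U e)" "\<And>e. L \<subseteq> U e" "\<And>e. U e \<subseteq> A" "decseq U"
  shows "\<exists>e0. \<forall>e\<ge>e0. \<exists>s. s \<notin> P \<and> (\<forall>m\<in>U e. s *s m \<in> U (Suc e))"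
  using assms unfolding locally_artinian_def by simp

text \<open>
  A chain in \<open>A/L\<close> is controlled by its image in \<open>A/B\<close> and its intersection with \<open>B/L\<close>.
\<close>

lemma locally_artinian_trans:
  assumes P: "prime_ideal P" and AB: "locally_artinian P L B" "locally_artinian P B A"
    and sub: "subspace L" "subspace B" "subspace A" "L \<subseteq> B" "B \<subseteq> A"
  shows "locally_artinian P L A"
  unfolding locally_artinian_def
proof (intro allI impI)
  fix U :: "nat \<Rightarrow> 'b set"
  assume U: "(\<forall>e. subspace (U e) \<and> L \<subseteq> U e \<and> U e \<subseteq> A) \<and> decseq U"
  define Y where "Y e = {u + b |u b. u \<in> U e \<and> b \<in> B}" for e
  have Usub: "subspace (U e)" and UA: "U e \<subseteq> A" and UL: "L \<subseteq> U e" for e using U by auto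
  have dec: "decseq U" using U by simp
  have Ysub: "subspace (Y e)" for e
  proof -
    have "Y e = span (U e \<union> B)"
      unfolding span_Un Y_def span_eq_iff[THEN iffD2, OF Usub[of e]]
        span_eq_iff[THEN iffD2, OF sub(2)] ..
    then show ?thesis by simp
  qed
  have "Y (Suc e) \<subseteq> Y e" for e
    using decseq_SucD[OF dec, of e] unfolding Y_def by blast
  then have Ydec: "decseq Y" by (simp add: decseq_Suc_iff)
  have BY: "B \<subseteq> Y e" for e
  proof
    fix b assume "b \<in> B"
    then have "0 + b \<in> Y e" unfolding Y_def using subspace_0[OF Usub[of e]] by blast
    then show "b \<in> Y e" by simp
  qed
  have YA: "Y e \<subseteq> A" for e
    using UA[of e] sub(5) subspace_add[OF sub(3)] unfolding Y_def by blast
  obtain e1 where e1: "\<forall>e\<ge>e1. \<exists>s. s \<notin> P \<and> (\<forall>m\<in>Y e. s *s m \<in> Y (Suc e))"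
    using locally_artinianD[OF AB(2) Ysub BY YA Ydec] ..
  have Bdec: "decseq (\<lambda>e. U e \<inter> B)" using decseq_SucD[OF dec] unfolding decseq_Suc_iff by blast
  have LB: "L \<subseteq> U e \<inter> B" for e using UL[of e] sub(4) by blast
  obtain e2 where e2:
    "\<forall>e\<ge>e2. \<exists>s. s \<notin> P \<and> (\<forall>m\<in>U e \<inter> B. s *s m \<in> U (Suc e) \<inter> B)"
    using locally_artinianD[OF AB(1) subspace_inter[OF Usub sub(2)] LB Int_lower2 Bdec] ..
  show "\<exists>e0. \<forall>e\<ge>e0. \<exists>s. s \<notin> P \<and> (\<forall>m\<in>U e. s *s m \<in> U (Suc e))"
  proof (intro exI[of _ "max e1 e2"] allI impI)
    fix e assume "max e1 e2 \<le> e"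
    then have "e1 \<le> e" "e2 \<le> e" by auto
    then obtain s t where s: "s \<notin> P" "\<And>m. m \<in> Y e \<Longrightarrow> s *s m \<in> Y (Suc e)"
      and t: "t \<notin> P" "\<And>m. m \<in> U e \<inter> B \<Longrightarrow> t *s m \<in> U (Suc e) \<inter> B"
      using e1 e2 by blast
    have "(t * s) *s m \<in> U (Suc e)" if m: "m \<in> U e" for m
    proof -
      have "m + 0 \<in> Y e" unfolding Y_def using m subspace_0[OF sub(2)] by blast
      then obtain u b where ub: "s *s m = u + b" "u \<in> U (Suc e)" "b \<in> B"
        using s(2)[of m] by (auto simp: Y_def)
      then have "b = s *s m - u" by simp
      moreover have "u \<in> U e" using ub(2) decseq_SucD[OF dec] by blast
      ultimately have "b \<in> U e \<inter> B"
        using ub(3) m subspace_diff[OF Usub] subspace_scale[OF Usub] by auto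
      then have "t *s b \<in> U (Suc e)" using t(2) by blast
      moreover have "t *s u \<in> U (Suc e)" using ub(2) subspace_scale[OF Usub] by blast
      ultimately have "t *s (s *s m) \<in> U (Suc e)"
        using ub(1) subspace_add[OF Usub] by (simp add: scale_right_distrib del: scale_scale)
      then show ?thesis by simp
    qed
    then show "\<exists>s. s \<notin> P \<and> (\<forall>m\<in>U e. s *s m \<in> U (Suc e))"
      using prime_ideal_mult_notin[OF P t(1) s(1)] by blast
  qed
qed

text \<open>
  Here \<open>(B + Ra)/B\<close> is \<open>R/Q\<close> with \<open>Q = (B : a)\<close>.  Under the hypothesis its localization at \<open>P\<close> is zero
  (if \<open>Q\<close> is not contained in \<open>P\<close>) or the field \<open>R\<^sub>P/PR\<^sub>P\<close> (if \<open>Q = P\<close>), hence has no infinite chains.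
\<close>

lemma locally_artinian_cyclic:
  assumes P: "prime_ideal P" and B: "subspace B"
    and min: "{r. r *s a \<in> B} \<subseteq> P \<Longrightarrow> {r. r *s a \<in> B} = P"
  shows "locally_artinian P B (span (insert a B))"
  unfolding locally_artinian_def
proof (intro allI impI)
  fix U :: "nat \<Rightarrow> 'b set"
  assume U: "(\<forall>e. subspace (U e) \<and> B \<subseteq> U e \<and> U e \<subseteq> span (insert a B)) \<and> decseq U"
  have Usub: "subspace (U e)" and BU: "B \<subseteq> U e" for e using U by auto
  have dec: "decseq U" using U by simp
  have split: "\<exists>r. u - r *s a \<in> B" if "u \<in> U e" for u e
    using U that span_breakdown_eq[of u a B] B span_eq_iff[of B] by blast
  have mult: "s *s u \<in> U (Suc e)" if s: "s *s a \<in> U (Suc e)" and u: "u \<in> U e" for s u e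
  proof -
    obtain r where "u - r *s a \<in> B" using split[OF u] by blast
    then have "s *s (u - r *s a) \<in> U (Suc e)" using BU subspace_scale[OF B] by blast
    moreover have "r *s (s *s a) \<in> U (Suc e)" using s subspace_scale[OF Usub] by blast
    moreover have "s *s u = s *s (u - r *s a) + r *s (s *s a)"
      by (simp add: scale_right_diff_distrib mult.commute)
    ultimately show ?thesis using subspace_add[OF Usub] by metis
  qed
  show "\<exists>e0. \<forall>e\<ge>e0. \<exists>s. s \<notin> P \<and> (\<forall>m\<in>U e. s *s m \<in> U (Suc e))"
  proof (cases "\<exists>e0. {r. r *s a \<in> U e0} \<subseteq> P")
    case True
    then obtain e0 where e0: "{r. r *s a \<in> U e0} \<subseteq> P" by blast
    then have eqP: "{r. r *s a \<in> B} = P" using min BU by blast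
    have "u \<in> U (Suc e)" if e: "e \<ge> e0" and u: "u \<in> U e" for e u
    proof -
      obtain r where r: "u - r *s a \<in> B" using split[OF u] by blast
      have "u \<in> U e0" using u decseqD[OF dec e] by blast
      moreover have "u - r *s a \<in> U e0" using r BU by blast
      ultimately have "u - (u - r *s a) \<in> U e0" using subspace_diff[OF Usub] by blast
      then have "r *s a \<in> B" using e0 eqP by auto
      from subspace_add[OF B r this] have "u \<in> B" by simp
      then show ?thesis using BU by blast
    qed
    then show ?thesis using prime_ideal_one_notin[OF P] by (intro exI[of _ e0]) (auto intro!: exI[of _ 1])
  next
    case False
    then show ?thesis using mult by blast
  qed
qed

end

context noetherian_module
begin

text \<open>
  A nonzero module over a noetherian ring has an associated prime; it appears as a maximal colon ideal.
\<close>

lemma prime_colon_exists: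
  assumes B: "subspace B" and a: "a \<in> A" "a \<notin> B" and A: "subspace A"
  shows "\<exists>a\<in>A. a \<notin> B \<and> prime_ideal {r. r *s a \<in> B}"
proof -
  interpret ideals: noetherian_module "(*) :: 'r \<Rightarrow> 'r \<Rightarrow> 'r"
    by (rule noetherian_module_mult[OF noetherian_ring])
  define F where "F = {{r. r *s a \<in> B} |a. a \<in> A \<and> a \<notin> B}"
  have colon: "ideal {r. r *s a \<in> B}" for a
    using ideal_colon[OF B, of "{a}"] by simp
  have "\<exists>I\<in>F. \<forall>J\<in>F. I \<subseteq> J \<longrightarrow> J = I"
    by (rule ideals.maximal_subspace_exists) (use a colon in \<open>auto simp: F_def\<close>)
  then obtain b where b: "b \<in> A" "b \<notin> B" and max:
    "\<And>c. c \<in> A \<Longrightarrow> c \<notin> B \<Longrightarrow> {r. r *s b \<in> B} \<subseteq> {r. r *s c \<in> B} \<Longrightarrow> {r. r *s c \<in> B} = {r. r *s b \<in> B}"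
    unfolding F_def by blast
  have "x *s b \<in> B" if xy: "(x * y) *s b \<in> B" "y *s b \<notin> B" for x y
  proof -
    have "r *s (y *s b) \<in> B" if "r *s b \<in> B" for r
      using subspace_scale[OF B that, of y] by (metis scale_left_commute)
    then have "{r. r *s (y *s b) \<in> B} = {r. r *s b \<in> B}"
      using max[of "y *s b"] subspace_scale[OF A b(1)] xy(2) by blast
    moreover have "x *s (y *s b) \<in> B" using xy(1) by simp
    ultimately show ?thesis by blast
  qed
  moreover have "{r. r *s b \<in> B} \<noteq> UNIV"
  proof
    assume "{r. r *s b \<in> B} = UNIV"
    then have "1 *s b \<in> B" by blast
    then show False using b by simp
  qed
  ultimately have "prime_ideal {r. r *s b \<in> B}"
    using colon unfolding prime_ideal_def by blast
  then show ?thesis using b by blast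
qed

text \<open>
  Filter \<open>A/L\<close> with quotients \<open>R/Q\<close>, \<open>Q\<close> prime; noetherianity makes the filtration reach \<open>A\<close>.  Every \<open>Q\<close>
  contains \<open>I\<close>, since \<open>r\<^sup>2 \<in> Q\<close> for \<open>r \<in> I\<close>.  By minimality of \<open>P\<close> each quotient is harmless at \<open>P\<close>.
\<close>

lemma locally_artinian_at_minimal_prime:
  assumes P: "minimal_prime_over I P"
    and sub: "subspace L" "subspace A" "L \<subseteq> A"
    and kill: "\<And>r m. r \<in> I \<Longrightarrow> m \<in> A \<Longrightarrow> r\<^sup>2 *s m \<in> L"
  shows "locally_artinian P L A"
proof -
  have prime: "prime_ideal P" using P by (simp add: minimal_prime_over_def)
  define F where "F = {B. subspace B \<and> L \<subseteq> B \<and> B \<subseteq> A \<and> locally_artinian P L B}"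
  have "locally_artinian P L L"
    unfolding locally_artinian_def
  proof (intro allI impI)
    fix U :: "nat \<Rightarrow> 'm set"
    assume "(\<forall>e. subspace (U e) \<and> L \<subseteq> U e \<and> U e \<subseteq> L) \<and> decseq U"
    then have "U e = L" for e by blast
    then show "\<exists>e0. \<forall>e\<ge>e0. \<exists>s. s \<notin> P \<and> (\<forall>m\<in>U e. s *s m \<in> U (Suc e))"
      using prime_ideal_one_notin[OF prime] by (auto intro!: exI[of _ 1])
  qed
  then have "L \<in> F" using sub by (auto simp: F_def)
  then have "\<exists>B\<in>F. \<forall>B'\<in>F. B \<subseteq> B' \<longrightarrow> B' = B"
    by (intro maximal_subspace_exists) (auto simp: F_def)
  then obtain B where BF: "B \<in> F" and max: "\<And>B'. B' \<in> F \<Longrightarrow> B \<subseteq> B' \<Longrightarrow> B' = B" by blast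
  then have B: "subspace B" "L \<subseteq> B" "B \<subseteq> A" "locally_artinian P L B" by (simp_all add: F_def)
  have "B = A"
  proof (rule ccontr)
    assume "B \<noteq> A"
    then obtain a where a: "a \<in> A" "a \<notin> B" "prime_ideal {r. r *s a \<in> B}"
      using prime_colon_exists[OF B(1) _ _ sub(2)] B(3) by blast
    have "I \<subseteq> {r. r *s a \<in> B}"
    proof
      fix r assume "r \<in> I"
      then have "r * r \<in> {r. r *s a \<in> B}" using kill[of r a] a(1) B(2) by (auto simp: power2_eq_square)
      then show "r \<in> {r. r *s a \<in> B}" using a(3) unfolding prime_ideal_def by blast
    qed
    then have "locally_artinian P B (span (insert a B))"
      using P a(3) by (intro locally_artinian_cyclic prime B) (auto simp: minimal_prime_over_def)
    moreover have le: "B \<subseteq> span (insert a B)" "a \<in> span (insert a B)" "span (insert a B) \<subseteq> A"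
      using span_superset[of "insert a B"] span_minimal[of "insert a B" A] a B sub by auto
    ultimately have "locally_artinian P L (span (insert a B))"
      using locally_artinian_trans[OF prime B(4)] sub B by blast
    then have "span (insert a B) \<in> F" using le B by (auto simp: F_def)
    then show False using max le a by blast
  qed
  then show ?thesis using B by simp
qed

text \<open>
  This is the argument of Hartshorne, Speiser, Lyubeznik and Gabber for the stabilization of images, in the
  form that it takes for Cartier algebras that need not be principal.  The operator \<open>\<Phi>\<close> stands for
  \<open>N \<mapsto> \<C>\<^sub>+N\<close>, which has the last property because \<open>r\<phi> = \<phi>r\<^bsup>p\<^sup>n\<^esup>\<close> for \<open>\<phi> \<in> \<C>\<^sub>n\<close> and \<open>p\<^sup>n \<ge> 2\<close>: multipliers can be moved
  inside \<open>\<Phi>\<close> at the gain of an exponent.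

  Let \<open>U\<^sub>e = \<Phi>\<^sup>eM\<close> and \<open>I\<^sub>e = (U\<^bsub>e+1\<^esub> : U\<^sub>e)\<close>.  If \<open>r \<in> I\<^sub>e\<close>, then \<open>r\<Phi>U\<^sub>e \<subseteq> \<Phi>r\<^sup>2U\<^sub>e \<subseteq> \<Phi>U\<^bsub>e+1\<^esub>\<close>, so the ideals \<open>I\<^sub>e\<close> increase and
  are equal to some \<open>I\<close> from an index \<open>n\<close> on.  For \<open>r \<in> I\<close> one has \<open>r\<^sup>2U\<^sub>n \<subseteq> r\<Phi>U\<^sub>n \<subseteq> \<Phi>r\<^sup>2U\<^sub>n\<close>, and iterating shows
  that \<open>r\<^sup>2U\<^sub>n\<close> lies in the intersection \<open>L\<close> of all \<open>U\<^sub>e\<close>.  Were \<open>I\<close> a proper ideal, \<open>U\<^sub>n/L\<close> would be artinian at a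
  minimal prime \<open>P\<close> over \<open>I\<close>, so that \<open>sU\<^sub>e \<subseteq> U\<^bsub>e+1\<^esub>\<close> for some \<open>s \<notin> P\<close> and some large \<open>e\<close>; but then \<open>s \<in> I \<subseteq> P\<close>.
\<close>

lemma contracting_iterates_stabilize:
  fixes \<Phi> :: "'m set \<Rightarrow> 'm set"
  assumes sub: "\<And>N. subspace N \<Longrightarrow> subspace (\<Phi> N)"
    and mono: "\<And>N N'. subspace N \<Longrightarrow> subspace N' \<Longrightarrow> N \<subseteq> N' \<Longrightarrow> \<Phi> N \<subseteq> \<Phi> N'"
    and contract: "\<And>r m N. subspace N \<Longrightarrow> m \<in> \<Phi> N \<Longrightarrow> r *s m \<in> \<Phi> ((\<lambda>m. r\<^sup>2 *s m) ` N)"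
  shows "\<exists>e0. \<forall>e\<ge>e0. (\<Phi> ^^ e) UNIV = (\<Phi> ^^ e0) UNIV"
proof -
  define U where "U e = (\<Phi> ^^ e) UNIV" for e
  have U_0: "U 0 = UNIV" and U_Suc: "U (Suc e) = \<Phi> (U e)" for e by (simp_all add: U_def)
  have Usub: "subspace (U e)" for e by (induction e) (simp_all add: U_0 U_Suc sub)
  have "U (Suc e) \<subseteq> U e" for e
    by (induction e) (simp add: U_0, metis U_Suc Usub mono)
  then have dec: "decseq U" by (simp add: decseq_Suc_iff)
  have scaled: "subspace ((\<lambda>m. r *s m) ` N)" if "subspace N" for r N
    using module_hom.subspace_image[OF module_hom_scale_self that] .
  define I where "I e = {r. \<forall>m\<in>U e. r *s m \<in> U (Suc e)}" for e
  have Iideal: "ideal (I e)" for e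
    unfolding I_def by (rule ideal_colon[OF Usub])
  have "I e \<subseteq> I (Suc e)" for e
  proof
    fix r assume r: "r \<in> I e"
    have "(\<lambda>m. r\<^sup>2 *s m) ` U e \<subseteq> U (Suc e)"
    proof
      fix n assume "n \<in> (\<lambda>m. r\<^sup>2 *s m) ` U e"
      then obtain m where "m \<in> U e" "n = r *s (r *s m)" by (auto simp: power2_eq_square)
      then show "n \<in> U (Suc e)" using r subspace_scale[OF Usub] unfolding I_def by blast
    qed
    then have "\<Phi> ((\<lambda>m. r\<^sup>2 *s m) ` U e) \<subseteq> U (Suc (Suc e))"
      unfolding U_Suc[of "Suc e"] by (intro mono scaled Usub)
    then show "r \<in> I (Suc e)"
      unfolding I_def using contract[OF Usub[of e], of _ r] U_Suc[of e] by auto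
  qed
  then have inc: "incseq I" by (intro incseq_SucI)
  interpret ideals: noetherian_module "(*) :: 'r \<Rightarrow> 'r \<Rightarrow> 'r"
    by (rule noetherian_module_mult[OF noetherian_ring])
  obtain n where n: "(\<Union>e. I e) = I n"
    using ideals.Union_chain_eq_member[OF Iideal inc] by blast
  then have In: "I e = I n" if "e \<ge> n" for e
    using incseqD[OF inc that] by blast
  have "1 \<in> I n"
  proof (rule ccontr)
    assume "1 \<notin> I n"
    then obtain P where P: "minimal_prime_over (I n) P"
      using minimal_prime_over_exists[OF noetherian_ring Iideal] by blast
    define L where "L = (\<Inter>e. U e)"
    have Lsub: "subspace L" unfolding L_def using Usub by (intro subspace_Int)
    have kill: "r\<^sup>2 *s m \<in> L" if r: "r \<in> I n" and m: "m \<in> U n" for r m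
    proof -
      have "(\<lambda>m. r\<^sup>2 *s m) ` U n \<subseteq> U (n + j)" for j
      proof (induction j)
        case 0
        then show ?case using subspace_scale[OF Usub] by auto
      next
        case (Suc j)
        have "r\<^sup>2 *s m \<in> \<Phi> ((\<lambda>m. r\<^sup>2 *s m) ` U n)" if "m \<in> U n" for m
        proof -
          have "r *s m \<in> \<Phi> (U n)" using r that by (auto simp: I_def U_Suc)
          then have "r *s (r *s m) \<in> \<Phi> ((\<lambda>m. r\<^sup>2 *s m) ` U n)" by (rule contract[OF Usub])
          then show ?thesis by (simp add: power2_eq_square)
        qed
        moreover have "\<Phi> ((\<lambda>m. r\<^sup>2 *s m) ` U n) \<subseteq> U (n + Suc j)"
          using mono[OF scaled[OF Usub] Usub Suc] by (simp add: U_Suc)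
        ultimately show ?case by blast
      qed
      moreover have "U (n + e) \<subseteq> U e" for e using decseqD[OF dec] by simp
      ultimately show ?thesis unfolding L_def using m by blast
    qed
    have "locally_artinian P L (U n)"
      using kill by (intro locally_artinian_at_minimal_prime[OF P Lsub Usub]) (auto simp: L_def)
    moreover have "decseq (\<lambda>e. U (n + e))" "L \<subseteq> U (n + e)" "U (n + e) \<subseteq> U n" for e
      using dec decseqD[OF dec, of n "n + e"] by (auto simp: decseq_Suc_iff L_def)
    ultimately obtain e s where s: "s \<notin> P" "\<forall>m\<in>U (n + e). s *s m \<in> U (n + Suc e)"
      using locally_artinianD[of P L "U n" "\<lambda>e. U (n + e)"] Usub by blast
    then have "s \<in> I n" using In[of "n + e"] by (auto simp: I_def)
    then show False using s P by (auto simp: minimal_prime_over_def)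
  qed
  have const: "U (Suc e) = U e" if "e \<ge> n" for e
  proof
    show "U (Suc e) \<subseteq> U e" by (rule decseq_SucD[OF dec])
    have "1 \<in> I e" using In[OF that] \<open>1 \<in> I n\<close> by simp
    then show "U e \<subseteq> U (Suc e)" by (auto simp: I_def)
  qed
  have "U e = U n" if "e \<ge> n" for e
    using that by (induction e rule: dec_induct) (simp_all add: const)
  then show ?thesis unfolding U_def by blast
qed

end

section \<open>Products and powers of ideals\<close>

lemma group_closure_subsetI:
  assumes "S \<subseteq> T" "0 \<in> T" "\<And>x y. x \<in> T \<Longrightarrow> y \<in> T \<Longrightarrow> x - y \<in> T"
  shows "group_closure S \<subseteq> T"
proof
  fix x assume "x \<in> group_closure S"
  then show "x \<in> T" by induction (use assms in auto)
qed

lemma group_closure_mono: "S \<subseteq> S' \<Longrightarrow> group_closure S \<subseteq> group_closure S'"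
  by (rule group_closure_subsetI) (auto intro: group_closure.base group_closure.diff)

context module
begin

lemma subspace_group_closure:
  assumes "\<And>c x. x \<in> S \<Longrightarrow> c *s x \<in> group_closure S"
  shows "subspace (group_closure S)"
proof (rule subspaceI)
  show "c *s x \<in> group_closure S" if "x \<in> group_closure S" for c x
    using that
  proof induction
    case (base s)
    then show ?case using assms by auto
  next
    case (diff s t)
    then show ?case by (simp add: scale_right_diff_distrib group_closure.diff)
  qed
qed (auto intro: group_closure_add)

lemma subspace_ideal_times:
  assumes N: "subspace N"
  shows "subspace (ideal_times scale I N)"
  unfolding ideal_times_def
proof (rule subspace_group_closure)
  fix c x assume "x \<in> {r *s m |r m. r \<in> I \<and> m \<in> N}"
  then obtain r m where "x = r *s m" "r \<in> I" "m \<in> N" by blast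
  then have "c *s x = r *s (c *s m)" "r \<in> I" "c *s m \<in> N"
    using subspace_scale[OF N] by (simp_all add: mult.commute)
  then show "c *s x \<in> group_closure {r *s m |r m. r \<in> I \<and> m \<in> N}"
    by (intro group_closure.base) blast
qed

lemma ideal_timesI: "r \<in> I \<Longrightarrow> m \<in> N \<Longrightarrow> r *s m \<in> ideal_times scale I N"
  unfolding ideal_times_def by (intro group_closure.base) blast

lemma ideal_times_subsetI:
  assumes "subspace T" "\<And>r m. r \<in> I \<Longrightarrow> m \<in> N \<Longrightarrow> r *s m \<in> T"
  shows "ideal_times scale I N \<subseteq> T"
  unfolding ideal_times_def using assms
  by (intro group_closure_subsetI) (auto simp: subspace_0 subspace_diff)

lemma ideal_times_mono: "I \<subseteq> I' \<Longrightarrow> N \<subseteq> N' \<Longrightarrow> ideal_times scale I N \<subseteq> ideal_times scale I' N'"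
  unfolding ideal_times_def by (intro group_closure_mono) blast

lemma subspace_vimage_scale: "subspace T \<Longrightarrow> subspace {m. r *s m \<in> T}"
  using module_hom.subspace_vimage[OF module_hom_scale_self, of T r] by (simp add: vimage_def)

end

lemma ideal_power_0 [simp]: "ideal_power I 0 = UNIV"
  and ideal_power_Suc [simp]: "ideal_power I (Suc k) = ideal_times (*) I (ideal_power I k)"
  by (simp_all add: ideal_power_def)

lemma ideal_ideal_power: "ideal (ideal_power I k)"
  by (induction k)
    (simp_all add: module.subspace_UNIV[OF module_mult] module.subspace_ideal_times[OF module_mult])

lemma ideal_power_mult:
  assumes "r \<in> ideal_power I i" "s \<in> ideal_power I j"
  shows "r * s \<in> ideal_power I (i + j)"
  using assms(1)
proof (induction i arbitrary: r)
  case 0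
  then show ?case using module.subspace_scale[OF module_mult ideal_ideal_power assms(2)] by simp
next
  case (Suc i)
  have "ideal {r. \<forall>t\<in>{s}. r * t \<in> ideal_power I (Suc i + j)}"
    by (rule module.ideal_colon[OF module_mult ideal_ideal_power])
  moreover have "(a * b) * s \<in> ideal_power I (Suc i + j)" if "a \<in> I" "b \<in> ideal_power I i" for a b
    using module.ideal_timesI[OF module_mult that(1) Suc.IH[OF that(2)]] by (simp add: mult.assoc)
  ultimately have "ideal_times (*) I (ideal_power I i) \<subseteq> {r. \<forall>t\<in>{s}. r * t \<in> ideal_power I (Suc i + j)}"
    by (intro module.ideal_times_subsetI[OF module_mult]) auto
  then show ?case using Suc.prems by auto
qed

lemma ideal_power_antimono: "i \<le> j \<Longrightarrow> ideal_power I j \<subseteq> ideal_power I i"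
proof (induction j rule: dec_induct)
  case (step j)
  have "ideal_power I (Suc j) \<subseteq> ideal_power I j"
    unfolding ideal_power_Suc
    by (intro module.ideal_times_subsetI[OF module_mult ideal_ideal_power]
        module.subspace_scale[OF module_mult ideal_ideal_power])
  then show ?case using step.IH by blast
qed simp

lemma ideal_power_1I: "r \<in> I \<Longrightarrow> r \<in> ideal_power I 1"
  using module.ideal_timesI[OF module_mult, of r I 1 UNIV] by simp

lemma power_in_ideal_power:
  assumes "r \<in> ideal_power I i"
  shows "r ^ n \<in> ideal_power I (i * n)"
proof (induction n)
  case (Suc n)
  show ?case using ideal_power_mult[OF assms Suc] by simp
qed simp

lemma prod_mset_in_ideal_power:
  assumes "set_mset A \<subseteq> I"
  shows "prod_mset A \<in> ideal_power I (size A)"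
  using assms
proof (induction A)
  case (add x A)
  then show ?case using module.ideal_timesI[OF module_mult, of x I "prod_mset A"] by simp
qed simp

lemma ideal_power_subset_monomials:
  assumes I: "I = module.span (*) X"
  shows "ideal_power I N \<subseteq> module.span (*) {prod_mset A |A. set_mset A \<subseteq> X \<and> size A = N}"
proof (induction N)
  case 0
  have "1 \<in> {prod_mset A |A::'a multiset. set_mset A \<subseteq> X \<and> size A = 0}" by auto
  from module.span_scale[OF module_mult module.span_base[OF module_mult this]]
  have "r * 1 \<in> module.span (*) {prod_mset A |A. set_mset A \<subseteq> X \<and> size A = 0}" for r .
  then show ?case by auto
next
  case (Suc N)
  define S where "S N = module.span (*) {prod_mset A |A. set_mset A \<subseteq> X \<and> size A = N}" for N
  have S: "ideal (S N)" for N unfolding S_def by (rule module.subspace_span[OF module_mult])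
  have "r * m \<in> S (Suc N)" if r: "r \<in> I" and m: "m \<in> S N" for r m
  proof -
    have "x * m \<in> S (Suc N)" if x: "x \<in> X" for x
    proof -
      have "{prod_mset A |A. set_mset A \<subseteq> X \<and> size A = N} \<subseteq> {m. x * m \<in> S (Suc N)}"
      proof clarify
        fix A assume "set_mset A \<subseteq> X" "N = size A"
        then have "prod_mset (add_mset x A) \<in> S (Suc (size A))"
          unfolding S_def using x
          by (intro module.span_base[OF module_mult] CollectI exI[of _ "add_mset x A"]) auto
        then show "x * prod_mset A \<in> S (Suc (size A))" by simp
      qed
      then have "S N \<subseteq> {m. x * m \<in> S (Suc N)}"
        unfolding S_def[of N]
        by (rule module.span_minimal[OF module_mult _ module.subspace_vimage_scale[OF module_mult S]])
      then show ?thesis using m by blast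
    qed
    then have "I \<subseteq> {r. \<forall>t\<in>{m}. r * t \<in> S (Suc N)}"
      unfolding I by (intro module.span_minimal[OF module_mult _ module.ideal_colon[OF module_mult S]]) auto
    then show ?thesis using r by blast
  qed
  then have "ideal_times (*) I (ideal_power I N) \<subseteq> S (Suc N)"
    using Suc unfolding S_def[symmetric]
    by (intro module.ideal_times_subsetI[OF module_mult S]) blast
  then show ?case by (simp add: S_def)
qed

lemma multiset_pigeonhole:
  assumes X: "finite X" "set_mset A \<subseteq> X" and size: "card X * (q - 1) < size A"
  shows "\<exists>x\<in>X. q \<le> count A x"
proof (rule ccontr)
  assume "\<not> ?thesis"
  then have "count A x \<le> q - 1" if "x \<in> X" for x using that by (auto simp: not_le)
  then have "(\<Sum>x\<in>X. count A x) \<le> card X * (q - 1)"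
    using sum_bounded_above[of X "count A" "q - 1"] by simp
  moreover have "size A = (\<Sum>x\<in>X. count A x)"
    unfolding size_multiset_overloaded_eq using X
    by (intro sum.mono_neutral_left) (auto simp: not_in_iff)
  ultimately show False using size by simp
qed

text \<open>
  A monomial of degree \<open>N > n(q - 1)\<close> in \<open>n\<close> generators is divisible by the \<open>q\<close>-th power of one of them, and
  the complementary factor has degree \<open>N - q\<close>.  For \<open>q = p\<^sup>e\<close> this says \<open>I\<^sup>N \<subseteq> I\<^bsup>[q]\<^esup> I\<^bsup>N-q\<^esup>\<close>, where
  \<open>I\<^bsup>[q]\<^esup>\<close> is the Frobenius power; \<open>B\<close> stands for any ideal containing this product.
\<close>

lemma ideal_power_subset_frobenius_multiple:
  assumes X: "finite X" "module.span (*) X = I" and N: "card X * (q - 1) < N"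
    and B: "ideal B" "\<And>y r. y \<in> I \<Longrightarrow> r \<in> ideal_power I (N - q) \<Longrightarrow> y ^ q * r \<in> B"
  shows "ideal_power I N \<subseteq> B"
proof -
  have XI: "X \<subseteq> I" using module.span_superset[OF module_mult, of X] X by simp
  have "{prod_mset A |A. set_mset A \<subseteq> X \<and> size A = N} \<subseteq> B"
  proof clarify
    fix A assume A: "set_mset A \<subseteq> X" "N = size A"
    then obtain x where x: "x \<in> X" "q \<le> count A x"
      using multiset_pigeonhole[OF X(1) A(1), of q] N by auto
    define A' where "A' = A - replicate_mset q x"
    have sub: "replicate_mset q x \<subseteq># A" using x(2) by (simp add: count_le_replicate_mset_subset_eq)
    then have A': "A = replicate_mset q x + A'" by (simp add: A'_def)
    then have "prod_mset A = x ^ q * prod_mset A'" by simp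
    moreover have "prod_mset A' \<in> ideal_power I (size A')"
      using A A' XI by (intro prod_mset_in_ideal_power) auto
    moreover have "size A' = size A - q" using A' by simp
    ultimately show "prod_mset A \<in> B" using B(2)[of x "prod_mset A'"] x XI A by auto
  qed
  then have "module.span (*) {prod_mset A |A. set_mset A \<subseteq> X \<and> size A = N} \<subseteq> B"
    by (rule module.span_minimal[OF module_mult _ B(1)])
  then show ?thesis using ideal_power_subset_monomials[of I X N] X by auto
qed

section \<open>F-regular modules\<close>

text \<open>
  F-regularity of \<open>M\<close> over the principal Cartier algebra generated by \<open>\<kappa>\<close>, expressed by the map \<open>k\<close> by which
  \<open>\<kappa>\<close> acts.  The algebra itself enters only in the last part.
\<close>

locale F_regular_module = noetherian_module scale
  for scale :: "'r::comm_ring_1 \<Rightarrow> 'm::ab_group_add \<Rightarrow> 'm" (infixr \<open>*s\<close> 75) +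
  fixes p :: nat and k :: "'m \<Rightarrow> 'm"
  assumes p_ge_2: "2 \<le> p"
    and k_add: "k (x + y) = k x + k y"
    and k_scale: "k (r ^ p *s x) = r *s k x"
    and k_surj: "range k = UNIV"
    and regular: "\<lbrakk>subspace N; k ` N \<subseteq> N; N \<noteq> {0};
      \<forall>P\<in>generic_points scale UNIV. localized scale P N = localized scale P UNIV\<rbrakk> \<Longrightarrow> N = UNIV"
begin

lemma k_0: "k 0 = 0"
  using k_add[of 0 0] by simp

lemma k_diff: "k (x - y) = k x - k y"
  using k_add[of "x - y" y] by simp

lemma iter_0 [simp]: "(k ^^ n) 0 = 0"
  by (induction n) (simp_all add: k_0)

lemma iter_add: "(k ^^ n) (x + y) = (k ^^ n) x + (k ^^ n) y"
  by (induction n) (simp_all add: k_add)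

lemma iter_diff: "(k ^^ n) (x - y) = (k ^^ n) x - (k ^^ n) y"
  by (induction n) (simp_all add: k_diff)

lemma iter_scale: "(k ^^ n) (r ^ (p ^ n) *s x) = r *s (k ^^ n) x"
proof (induction n arbitrary: r)
  case (Suc n)
  have "(k ^^ n) (r ^ (p ^ Suc n) *s x) = r ^ p *s (k ^^ n) x"
    using Suc[of "r ^ p"] by (simp add: power_mult)
  then show ?case by (simp add: k_scale)
qed simp

lemma iter_image_UNIV: "range (k ^^ n) = UNIV"
  by (induction n) (simp_all add: comp_surj k_surj del: comp_apply)

lemma iter_image_add: "(k ^^ (m + n)) ` N = (k ^^ m) ` (k ^^ n) ` N"
  by (simp add: funpow_add image_comp)

lemma subspace_iter_image:
  assumes N: "subspace N"
  shows "subspace ((k ^^ n) ` N)"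
proof (rule subspaceI)
  show "0 \<in> (k ^^ n) ` N" using subspace_0[OF N] by (metis image_eqI iter_0)
  show "x + y \<in> (k ^^ n) ` N" if "x \<in> (k ^^ n) ` N" "y \<in> (k ^^ n) ` N" for x y
    using that subspace_add[OF N] by (auto simp flip: iter_add)
  show "c *s x \<in> (k ^^ n) ` N" if "x \<in> (k ^^ n) ` N" for c x
    using that subspace_scale[OF N] by (auto simp flip: iter_scale)
qed

text \<open>
  A multiplier \<open>r\<close> moves inside \<open>k\<^sup>n\<close> as \<open>r\<^bsup>p\<^sup>n\<^esup>\<close>.  Leaving \<open>J'\<close> arbitrary allows replacing the Frobenius power of \<open>J\<close> by
  the larger ordinary power when \<open>J\<close> is a power of \<open>\<aa>\<close>.
\<close>

lemma ideal_times_iter_image: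
  assumes N: "subspace N" and J: "\<And>r. r \<in> J \<Longrightarrow> r ^ (p ^ n) \<in> J'"
  shows "ideal_times scale J ((k ^^ n) ` N) \<subseteq> (k ^^ n) ` ideal_times scale J' N"
proof (rule ideal_times_subsetI)
  show "subspace ((k ^^ n) ` ideal_times scale J' N)"
    by (intro subspace_iter_image subspace_ideal_times N)
  fix r m assume "r \<in> J" "m \<in> (k ^^ n) ` N"
  then show "r *s m \<in> (k ^^ n) ` ideal_times scale J' N"
    using J ideal_timesI by (auto simp flip: iter_scale)
qed

text \<open>
  The submodules \<open>k\<^sup>e(JM)\<close> increase, since \<open>JM = J k(M) = k(J\<^bsup>[p]\<^esup>M) \<subseteq> k(JM)\<close>.  Their union is stable under \<open>k\<close>
  and contains \<open>JM\<close>, which is all of \<open>M\<close> at the generic points; by F-regularity it is \<open>M\<close>, and it is reached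
  after finitely many steps.

  This is the form in which F-regularity is used everywhere below: \<open>M\<close> may be replaced by \<open>k\<^sup>e(JM)\<close>, which
  creates an additional factor \<open>J\<close> under an iterate of \<open>k\<close>.
\<close>

lemma strongly_F_regular:
  assumes J: "ideal J" and generic: "\<And>P. P \<in> generic_points scale UNIV \<Longrightarrow> \<exists>r\<in>J. r \<notin> P"
  shows "\<exists>e. (k ^^ e) ` ideal_times scale J UNIV = UNIV"
proof -
  define JM where "JM = ideal_times scale J UNIV"
  define W where "W e = (k ^^ e) ` JM" for e
  have JM: "subspace JM" unfolding JM_def by (intro subspace_ideal_times subspace_UNIV)
  have Wsub: "subspace (W e)" for e unfolding W_def by (rule subspace_iter_image[OF JM])
  have "r ^ (p ^ 1) \<in> J" if "r \<in> J" for r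
    using module.subspace_scale[OF module_mult J that, of "r ^ (p - 1)"] p_ge_2
    by (simp flip: power_Suc2)
  then have "JM \<subseteq> (k ^^ 1) ` JM"
    using ideal_times_iter_image[OF subspace_UNIV, of J 1 J] iter_image_UNIV[of 1] by (simp add: JM_def)
  then have step: "W e \<subseteq> W (Suc e)" for e
    unfolding W_def using iter_image_add[of e 1 JM] by auto
  have "incseq W" using step by (rule incseq_SucI)
  then obtain n where n: "(\<Union>e. W e) = W n"
    using Union_chain_eq_member[of W, OF Wsub] by blast
  have "W n = UNIV"
  proof (cases "(UNIV :: 'm set) = {0}")
    case True
    have "{0} \<subseteq> W n" using subspace_0[OF Wsub[of n]] by simp
    then have "UNIV \<subseteq> W n" unfolding True .
    then show ?thesis by (rule top.extremum_uniqueI)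
  next
    case False
    obtain P where P: "P \<in> generic_points scale UNIV" using generic_point_exists[OF False] by blast
    have "W 0 = JM" by (simp add: W_def)
    then have JMW: "JM \<subseteq> W n" using n by blast
    show ?thesis
    proof (rule regular)
      show "subspace (W n)" by (rule Wsub)
      have "k ` W n = W (Suc n)" by (simp add: W_def image_comp)
      then show "k ` W n \<subseteq> W n" using n by blast
      show "W n \<noteq> {0}"
      proof
        assume W0: "W n = {0}"
        obtain r where r: "r \<in> J" "r \<notin> P" using generic[OF P] by blast
        then have "r *s m = 0" for m
          using ideal_timesI[of r J m UNIV] JMW W0 by (auto simp: JM_def)
        then have "r \<in> annihilator scale" by (auto simp: annihilator_def)
        then show False using r P by (auto simp: generic_points_UNIV minimal_prime_over_def)
      qed
      show "\<forall>P\<in>generic_points scale UNIV. localized scale P (W n) = localized scale P UNIV"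
      proof
        fix P assume P: "P \<in> generic_points scale UNIV"
        then obtain r where r: "r \<in> J" "r \<notin> P" using generic by blast
        have "r *s m \<in> W n" for m using ideal_timesI[OF r(1), of m UNIV] JMW by (auto simp: JM_def)
        moreover have "prime_ideal P" using P by (simp add: generic_points_UNIV minimal_prime_over_def)
        ultimately show "localized scale P (W n) = localized scale P UNIV"
          using localized_eq_UNIV r(2) by blast
      qed
    qed
  qed
  then show ?thesis unfolding W_def JM_def by blast
qed

end

section \<open>The filtration\<close>

locale F_regular_module_with_ideal = F_regular_module scale p k
  for scale :: "'r::comm_ring_1 \<Rightarrow> 'm::ab_group_add \<Rightarrow> 'm" (infixr \<open>*s\<close> 75) and p k +
  fixes \<aa> :: "'r set" and x :: 'r
  assumes ideal_\<aa>: "ideal \<aa>" and x_in: "x \<in> \<aa>" and x_regular: "x *s m = 0 \<Longrightarrow> m = 0"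
begin

definition \<aa>M :: "nat \<Rightarrow> 'm set" where
  "\<aa>M j = ideal_times scale (ideal_power \<aa> j) UNIV"

definition ceil_exp :: "rat \<Rightarrow> nat \<Rightarrow> nat" where
  "ceil_exp t n = nat \<lceil>t * of_nat p ^ n\<rceil>"

text \<open>
  The conversion to natural numbers truncates the exponent at \<open>0\<close>, where \<open>\<aa>\<^sup>0M = M\<close>; so this formula also
  gives the value \<open>M\<close> at negative indices.
\<close>

definition V :: "rat \<Rightarrow> 'm set" where
  "V t = (\<Union>n. (k ^^ n) ` \<aa>M (ceil_exp t n))"

lemma nat_ceiling_le_iff: "nat \<lceil>y :: rat\<rceil> \<le> j \<longleftrightarrow> y \<le> of_nat j"
  by (simp add: nat_le_iff ceiling_le_iff)

lemma ceil_exp_le_iff: "ceil_exp t n \<le> j \<longleftrightarrow> t * of_nat p ^ n \<le> of_nat j"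
  unfolding ceil_exp_def by (rule nat_ceiling_le_iff)

lemma le_ceil_exp: "t * of_nat p ^ n \<le> of_nat (ceil_exp t n)"
  using ceil_exp_le_iff by blast

lemma subspace_\<aa>M: "subspace (\<aa>M j)"
  unfolding \<aa>M_def by (intro subspace_ideal_times subspace_UNIV)

lemma \<aa>M_antimono: "i \<le> j \<Longrightarrow> \<aa>M j \<subseteq> \<aa>M i"
  unfolding \<aa>M_def by (intro ideal_times_mono ideal_power_antimono) auto

lemma \<aa>M_0: "\<aa>M 0 = UNIV"
  unfolding \<aa>M_def using ideal_timesI[of 1 UNIV _ UNIV] by auto

lemma \<aa>M_mult:
  assumes "r \<in> ideal_power \<aa> i" "m \<in> \<aa>M j"
  shows "r *s m \<in> \<aa>M (i + j)"
proof -
  have "r *s (s *s m) \<in> \<aa>M (i + j)" if "s \<in> ideal_power \<aa> j" for s m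
    using ideal_timesI[OF ideal_power_mult[OF assms(1) that], of m UNIV] by (simp add: \<aa>M_def)
  then have "\<aa>M j \<subseteq> {m. r *s m \<in> \<aa>M (i + j)}"
    unfolding \<aa>M_def[of j] by (intro ideal_times_subsetI subspace_vimage_scale subspace_\<aa>M) simp
  then show ?thesis using assms(2) by blast
qed

text \<open>
  Write \<open>M = k\<^sup>e(N)\<close> and move \<open>\<aa>\<^sup>j\<close> inside: \<open>\<aa>\<^sup>jM = k\<^sup>e((\<aa>\<^sup>j)\<^bsup>[p\<^sup>e]\<^esup>N) \<subseteq> k\<^sup>e(\<aa>\<^bsup>jp\<^sup>e\<^esup>N)\<close>.  With \<open>N = M\<close> this makes the sets
  whose union is \<open>V\<^sup>t\<close> increase; with smaller \<open>N\<close> it yields right-continuity and minimality.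
\<close>

lemma \<aa>M_subset_iter_image:
  assumes "(k ^^ e) ` N = UNIV" "subspace N"
  shows "\<aa>M j \<subseteq> (k ^^ e) ` ideal_times scale (ideal_power \<aa> (j * p ^ e)) N"
  unfolding \<aa>M_def assms(1)[symmetric]
  by (intro ideal_times_iter_image assms(2) power_in_ideal_power)

lemma iter_image_\<aa>M_subset_V:
  assumes "t * of_nat p ^ n \<le> of_nat j"
  shows "(k ^^ n) ` \<aa>M j \<subseteq> V t"
proof -
  have "ceil_exp t n \<le> j" using assms by (simp add: ceil_exp_le_iff)
  then have "\<aa>M j \<subseteq> \<aa>M (ceil_exp t n)" by (rule \<aa>M_antimono)
  then show ?thesis unfolding V_def by blast
qed

lemma incseq_V: "incseq (\<lambda>n. (k ^^ n) ` \<aa>M (ceil_exp t n))"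
proof (rule incseq_SucI)
  fix n
  have "t * of_nat p ^ n * of_nat p \<le> of_nat (ceil_exp t n) * of_nat p"
    by (intro mult_right_mono le_ceil_exp) simp
  then have le: "ceil_exp t (Suc n) \<le> ceil_exp t n * p ^ 1"
    by (simp add: ceil_exp_le_iff mult_ac)
  have "\<aa>M (ceil_exp t n) \<subseteq> (k ^^ 1) ` \<aa>M (ceil_exp t n * p ^ 1)"
    using \<aa>M_subset_iter_image[OF iter_image_UNIV subspace_UNIV, of _ 1] by (simp add: \<aa>M_def)
  also have "\<dots> \<subseteq> (k ^^ 1) ` \<aa>M (ceil_exp t (Suc n))" by (intro image_mono \<aa>M_antimono le)
  finally have "(k ^^ n) ` \<aa>M (ceil_exp t n) \<subseteq> (k ^^ n) ` (k ^^ 1) ` \<aa>M (ceil_exp t (Suc n))"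
    by (rule image_mono)
  then show "(k ^^ n) ` \<aa>M (ceil_exp t n) \<subseteq> (k ^^ Suc n) ` \<aa>M (ceil_exp t (Suc n))"
    using iter_image_add[of n 1] by simp
qed

lemma V_eq_iter_image: "\<exists>n. V t = (k ^^ n) ` \<aa>M (ceil_exp t n)"
  unfolding V_def using Union_chain_eq_member[OF subspace_iter_image[OF subspace_\<aa>M] incseq_V] .

lemma subspace_V: "subspace (V t)"
  using V_eq_iter_image[of t] subspace_iter_image[OF subspace_\<aa>M] by metis

lemma V_cases:
  assumes "m \<in> V t"
  obtains n a where "a \<in> \<aa>M (ceil_exp t n)" "m = (k ^^ n) a"
  using assms unfolding V_def by blast

lemma V_antimono: "antimono V"
proof (rule antimonoI)
  fix s t :: rat assume "s \<le> t"
  then have "s * of_nat p ^ n \<le> of_nat (ceil_exp t n)" for n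
    using order_trans[OF mult_right_mono[of s t "of_nat p ^ n"] le_ceil_exp] by simp
  then show "V t \<subseteq> V s" unfolding V_def[of t] using iter_image_\<aa>M_subset_V by blast
qed

lemma V_nonpos: "t \<le> 0 \<Longrightarrow> V t = UNIV"
  using iter_image_\<aa>M_subset_V[of t 0 0] by (auto simp: \<aa>M_0)

lemma regular_principal_ideal_avoids_generic_point: "\<exists>r\<in>module.span (*) {x}. r \<notin> P" if "P \<in> generic_points scale UNIV"
  using regular_notin_generic_point[OF x_regular that] module.span_base[OF module_mult, of x "{x}"] by blast

text \<open>
  Choose \<open>e\<close> with \<open>k\<^sup>e(xM) = M\<close>.  Then \<open>V\<^sup>t = k\<^sup>n(\<aa>\<^sup>jM) \<subseteq> k\<^bsup>n+e\<^esup>(\<aa>\<^bsup>jp\<^sup>e\<^esup>xM) \<subseteq> k\<^bsup>n+e\<^esup>(\<aa>\<^bsup>jp\<^sup>e+1\<^esup>M)\<close>, and the gain of \<open>1\<close> in the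
  exponent is a gain of \<open>1/p\<^bsup>n+e\<^esup>\<close> in the index.
\<close>

lemma V_right_continuous: "\<exists>\<delta>>0. V (t + \<delta>) = V t"
proof -
  define xM where "xM = ideal_times scale (module.span (*) {x}) UNIV"
  have xM_sub: "subspace xM" unfolding xM_def by (intro subspace_ideal_times subspace_UNIV)
  obtain e where e: "(k ^^ e) ` xM = UNIV"
    using strongly_F_regular[OF module.subspace_span[OF module_mult] regular_principal_ideal_avoids_generic_point]
    unfolding xM_def by blast
  have xM: "xM \<subseteq> \<aa>M 1"
    unfolding xM_def \<aa>M_def
  proof (intro ideal_times_mono)
    show "module.span (*) {x} \<subseteq> ideal_power \<aa> 1"
      using ideal_power_1I[OF x_in] by (intro module.span_minimal[OF module_mult _ ideal_ideal_power]) auto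
  qed simp
  obtain n where n: "V t = (k ^^ n) ` \<aa>M (ceil_exp t n)" using V_eq_iter_image by blast
  define j where "j = ceil_exp t n * p ^ e"
  have "ideal_times scale (ideal_power \<aa> j) xM \<subseteq> \<aa>M (j + 1)"
    using \<aa>M_mult xM by (intro ideal_times_subsetI subspace_\<aa>M) blast
  then have "\<aa>M (ceil_exp t n) \<subseteq> (k ^^ e) ` \<aa>M (j + 1)"
    using \<aa>M_subset_iter_image[OF e xM_sub, of "ceil_exp t n"] unfolding j_def by blast
  then have "V t \<subseteq> (k ^^ (n + e)) ` \<aa>M (j + 1)"
    unfolding n iter_image_add by (rule image_mono)
  also have "\<dots> \<subseteq> V (t + 1 / of_nat p ^ (n + e))"
  proof (rule iter_image_\<aa>M_subset_V)
    have "t * of_nat p ^ n * of_nat p ^ e \<le> of_nat (ceil_exp t n) * of_nat p ^ e"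
      by (intro mult_right_mono le_ceil_exp) simp
    moreover have "(t + 1 / of_nat p ^ (n + e)) * of_nat p ^ (n + e) = t * of_nat p ^ n * of_nat p ^ e + 1"
      using p_ge_2 by (simp add: distrib_right power_add)
    ultimately show "(t + 1 / of_nat p ^ (n + e)) * of_nat p ^ (n + e) \<le> of_nat (j + 1)"
      by (simp add: j_def)
  qed
  finally have "V t \<subseteq> V (t + 1 / of_nat p ^ (n + e))" .
  moreover have "1 / of_nat p ^ (n + e) > (0::rat)" using p_ge_2 by simp
  moreover have "V (t + 1 / of_nat p ^ (n + e)) \<subseteq> V t"
    using antimonoD[OF V_antimono, of t "t + 1 / of_nat p ^ (n + e)"] by simp
  ultimately show ?thesis by blast
qed

lemma V_mult:
  assumes "r \<in> ideal_power \<aa> j" "m \<in> V t"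
  shows "r *s m \<in> V (t + of_nat j)"
proof -
  obtain n a where a: "a \<in> \<aa>M (ceil_exp t n)" "m = (k ^^ n) a" using assms(2) by (rule V_cases)
  have "r *s m = (k ^^ n) (r ^ (p ^ n) *s a)" using a by (simp add: iter_scale)
  moreover have "r ^ (p ^ n) *s a \<in> \<aa>M (j * p ^ n + ceil_exp t n)"
    by (intro \<aa>M_mult power_in_ideal_power assms(1) a(1))
  moreover have "(t + of_nat j) * of_nat p ^ n \<le> of_nat (j * p ^ n + ceil_exp t n)"
    using le_ceil_exp[of t n] by (simp add: distrib_right)
  ultimately show ?thesis using iter_image_\<aa>M_subset_V by blast
qed

lemma power_x_in: "x ^ j \<in> ideal_power \<aa> j"
  using power_in_ideal_power[OF ideal_power_1I[OF x_in], of j] by simp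

lemma power_x_mult_in_V: "\<exists>j. \<forall>m. x ^ j *s m \<in> V t"
proof -
  obtain j :: nat where j: "t \<le> of_nat j" using real_arch_simple by blast
  have "x ^ j *s m \<in> V t" for m
  proof -
    have "m \<in> V (t - of_nat j)" using V_nonpos[of "t - of_nat j"] j by simp
    from V_mult[OF power_x_in[of j] this] show ?thesis by simp
  qed
  then show ?thesis by blast
qed

lemma k_image_V: "k ` V (t * of_nat p) = V t"
proof -
  have "ceil_exp (t * of_nat p) n = ceil_exp t (Suc n)" for n
    by (simp add: ceil_exp_def mult_ac)
  then have "k ` V (t * of_nat p) = (\<Union>n. (k ^^ Suc n) ` \<aa>M (ceil_exp t (Suc n)))"
    by (simp add: V_def image_UN image_comp)
  also have "\<dots> = V t"
    unfolding V_def
  proof (intro subset_antisym UN_least)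
    fix n
    show "(k ^^ n) ` \<aa>M (ceil_exp t n) \<subseteq> (\<Union>n. (k ^^ Suc n) ` \<aa>M (ceil_exp t (Suc n)))"
      using incseq_SucD[OF incseq_V[of t], of n] by blast
  qed blast
  finally show ?thesis .
qed

text \<open>
  For \<open>t > n\<close>, the exponent \<open>\<lceil>tp\<^sup>e\<rceil>\<close> is large enough to split off \<open>\<aa>\<^bsup>[p\<^sup>e]\<^esup>\<close>, which leaves \<open>k\<^sup>e\<close> as a factor \<open>\<aa>\<close>; the
  remaining exponent is \<open>\<lceil>tp\<^sup>e\<rceil> - p\<^sup>e = \<lceil>(t - 1)p\<^sup>e\<rceil>\<close>.
\<close>

lemma V_skoda:
  assumes X: "finite X" "module.span (*) X = \<aa>" and t: "t > of_nat (card X)"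
  shows "V t = ideal_times scale \<aa> (V (t - 1))"
proof
  show "ideal_times scale \<aa> (V (t - 1)) \<subseteq> V t"
    using V_mult[OF ideal_power_1I, of _ _ "t - 1"] by (intro ideal_times_subsetI subspace_V) simp
  have "(k ^^ n) ` \<aa>M (ceil_exp t n) \<subseteq> ideal_times scale \<aa> (V (t - 1))" for n
  proof -
    define q where "q = p ^ n"
    define N where "N = ceil_exp t n"
    define B where "B = ideal_times scale {y ^ q |y. y \<in> \<aa>} (\<aa>M (N - q))"
    have B: "subspace B" unfolding B_def by (intro subspace_ideal_times subspace_\<aa>M)
    have "of_nat (card X) * of_nat q < t * (of_nat q :: rat)"
      using t p_ge_2 by (intro mult_strict_right_mono) (auto simp: q_def)
    also have "\<dots> \<le> of_nat N" using le_ceil_exp[of t n] by (simp add: q_def N_def)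
    finally have "card X * q < N" by (metis of_nat_less_iff of_nat_mult)
    then have N: "card X * (q - 1) < N" by (meson diff_le_self le_less_trans mult_le_mono2)
    have "r *s m \<in> B" if r: "r \<in> ideal_power \<aa> N" for r m
    proof -
      have "ideal_power \<aa> N \<subseteq> {r. \<forall>t\<in>{m}. r *s t \<in> B}"
      proof (rule ideal_power_subset_frobenius_multiple[OF X N ideal_colon[OF B]])
        fix y r assume "y \<in> \<aa>" "r \<in> ideal_power \<aa> (N - q)"
        then have "y ^ q *s (r *s m) \<in> B"
          unfolding B_def \<aa>M_def by (intro ideal_timesI) auto
        then show "y ^ q * r \<in> {r. \<forall>t\<in>{m}. r *s t \<in> B}" by simp
      qed
      then show ?thesis using r by blast
    qed
    then have "\<aa>M N \<subseteq> B" unfolding \<aa>M_def by (intro ideal_times_subsetI B)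
    moreover have "B \<subseteq> {m. (k ^^ n) m \<in> ideal_times scale \<aa> (V (t - 1))}"
    proof -
      have "\<lceil>t * of_nat q - of_nat q\<rceil> = \<lceil>t * of_nat q\<rceil> - int q"
        using ceiling_diff_of_int[of "t * of_nat q" "int q"] by simp
      then have "nat \<lceil>t * of_nat q - of_nat q\<rceil> = nat \<lceil>t * of_nat q\<rceil> - q" by linarith
      then have "N - q = ceil_exp (t - 1) n"
        by (simp add: N_def q_def ceil_exp_def left_diff_distrib)
      then have "(k ^^ n) ` \<aa>M (N - q) \<subseteq> V (t - 1)"
        using iter_image_\<aa>M_subset_V[OF le_ceil_exp] by simp
      then have "y *s (k ^^ n) m \<in> ideal_times scale \<aa> (V (t - 1))" if "y \<in> \<aa>" "m \<in> \<aa>M (N - q)" for y m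
        using that by (intro ideal_timesI) auto
      then show ?thesis
        unfolding B_def ideal_times_def[of _ "{y ^ q |y. y \<in> \<aa>}"]
        by (intro group_closure_subsetI)
          (auto simp: q_def iter_scale iter_diff subspace_0 subspace_diff subspace_ideal_times subspace_V)
    qed
    ultimately show ?thesis unfolding N_def by blast
  qed
  then show "V t \<subseteq> ideal_times scale \<aa> (V (t - 1))" unfolding V_def[of t] by blast
qed

section \<open>The filtration consists of test modules\<close>

definition twist_exp :: "rat \<Rightarrow> nat \<Rightarrow> nat" where
  "twist_exp t n = nat \<lceil>t * (of_nat p ^ n - 1)\<rceil>"

definition twist_stable :: "rat \<Rightarrow> 'm set \<Rightarrow> bool" where
  "twist_stable t N \<longleftrightarrow> (\<forall>n. \<forall>r\<in>ideal_power \<aa> (twist_exp t n). \<forall>m\<in>N. (k ^^ n) (r *s m) \<in> N)"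

text \<open>
  \<open>k\<^sup>n(\<aa>\<^sup>i k\<^sup>l(\<aa>\<^sup>jM)) \<subseteq> k\<^bsup>n+l\<^esup>(\<aa>\<^bsup>ip\<^sup>l+j\<^esup>M)\<close>, and \<open>i \<ge> t(p\<^sup>n - 1)\<close>, \<open>j \<ge> tp\<^sup>l\<close> give \<open>ip\<^sup>l + j \<ge> tp\<^bsup>n+l\<^esup>\<close>.
\<close>

lemma twist_stable_V: "twist_stable t (V t)"
  unfolding twist_stable_def
proof (intro allI ballI)
  fix n r m assume r: "r \<in> ideal_power \<aa> (twist_exp t n)" and m: "m \<in> V t"
  from m obtain l a where a: "a \<in> \<aa>M (ceil_exp t l)" "m = (k ^^ l) a" by (rule V_cases)
  have "(k ^^ n) (r *s m) = (k ^^ (n + l)) (r ^ (p ^ l) *s a)"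
    using a by (simp add: iter_scale funpow_add)
  moreover have "r ^ (p ^ l) *s a \<in> \<aa>M (twist_exp t n * p ^ l + ceil_exp t l)"
    by (intro \<aa>M_mult power_in_ideal_power r a(1))
  moreover have "t * of_nat p ^ (n + l) \<le> of_nat (twist_exp t n * p ^ l + ceil_exp t l)"
  proof -
    have "t * (of_nat p ^ n - 1) \<le> of_nat (twist_exp t n)"
      using nat_ceiling_le_iff unfolding twist_exp_def by blast
    then have "t * (of_nat p ^ n - 1) * of_nat p ^ l \<le> of_nat (twist_exp t n) * of_nat p ^ l"
      by (intro mult_right_mono) auto
    then show ?thesis using le_ceil_exp[of t l] by (simp add: power_add algebra_simps)
  qed
  ultimately show "(k ^^ n) (r *s m) \<in> V t" using iter_image_\<aa>M_subset_V by blast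
qed

text \<open>
  Let \<open>J\<close> be the ideal of multipliers carrying \<open>M\<close> into \<open>N\<close>.  It lies in no generic point, so \<open>M = k\<^sup>e(JM)\<close> for
  some \<open>e\<close>, and \<open>k\<^sup>n(\<aa>\<^sup>jM) \<subseteq> k\<^bsup>n+e\<^esup>(\<aa>\<^bsup>jp\<^sup>e\<^esup>JM) \<subseteq> k\<^bsup>n+e\<^esup>(\<aa>\<^bsup>jp\<^sup>e\<^esup>N)\<close>.  For \<open>j \<ge> tp\<^sup>n\<close> the exponent is at least
  \<open>t(p\<^bsup>n+e\<^esup> - 1)\<close>, so the right-hand side stays in \<open>N\<close>.
\<close>

lemma V_minimal:
  assumes t: "t \<ge> 0" and N: "subspace N" "twist_stable t N"
    and generic: "\<And>P. P \<in> generic_points scale UNIV \<Longrightarrow> localized scale P N = localized scale P UNIV"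
  shows "V t \<subseteq> N"
proof -
  define J where "J = {r. \<forall>m\<in>UNIV. r *s m \<in> N}"
  have J: "ideal J" unfolding J_def by (rule ideal_colon[OF N(1)])
  have "\<exists>r\<in>J. r \<notin> P" if P: "P \<in> generic_points scale UNIV" for P
  proof -
    have prime: "prime_ideal P" using P by (simp add: generic_points_UNIV minimal_prime_over_def)
    have "\<exists>u. u \<notin> P \<and> u *s m \<in> N" for m
      using localized_memD[OF prime N(1) generic[OF P]] by blast
    from uniform_denominator[OF prime N(1) fin_gen_UNIV this] show ?thesis by (auto simp: J_def)
  qed
  then obtain e where e: "(k ^^ e) ` ideal_times scale J UNIV = UNIV"
    using strongly_F_regular[OF J] by blast
  have JM: "ideal_times scale J UNIV \<subseteq> N" by (rule ideal_times_subsetI[OF N(1)]) (simp add: J_def)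
  show ?thesis
  proof
    fix m assume "m \<in> V t"
    then obtain n a where a: "a \<in> \<aa>M (ceil_exp t n)" "m = (k ^^ n) a" by (rule V_cases)
    define j where "j = ceil_exp t n * p ^ e"
    obtain b where b: "b \<in> ideal_times scale (ideal_power \<aa> j) (ideal_times scale J UNIV)"
      "a = (k ^^ e) b"
      using \<aa>M_subset_iter_image[OF e subspace_ideal_times[OF subspace_UNIV], of "ceil_exp t n"] a(1)
      unfolding j_def by blast
    have "twist_exp t (n + e) \<le> j"
    proof -
      have "t * of_nat p ^ n * of_nat p ^ e \<le> of_nat (ceil_exp t n) * of_nat p ^ e"
        by (intro mult_right_mono le_ceil_exp) simp
      then show ?thesis
        using t by (simp add: twist_exp_def nat_ceiling_le_iff j_def power_add algebra_simps)
    qed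
    then have "(k ^^ (n + e)) (r *s c) \<in> N"
      if "r \<in> ideal_power \<aa> j" "c \<in> ideal_times scale J UNIV" for r c
      using that ideal_power_antimono JM N(2) unfolding twist_stable_def by blast
    then have "ideal_times scale (ideal_power \<aa> j) (ideal_times scale J UNIV) \<subseteq> {c. (k ^^ (n + e)) c \<in> N}"
      unfolding ideal_times_def[of _ "ideal_power \<aa> j"]
      by (intro group_closure_subsetI) (auto simp: iter_diff subspace_0 subspace_diff N(1))
    then show "m \<in> N" using a b by (auto simp: funpow_add)
  qed
qed

text \<open>
  \<open>\<C>\<^sub>+N\<close> for the algebra twisted by \<open>\<aa>\<^sup>t\<close>.
\<close>

definition twist_image :: "rat \<Rightarrow> 'm set \<Rightarrow> 'm set" where
  "twist_image t N = group_closure {(k ^^ n) (r *s m) |n r m.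
     1 \<le> n \<and> r \<in> ideal_power \<aa> (twist_exp t n) \<and> m \<in> N}"

lemma twist_imageI:
  "1 \<le> n \<Longrightarrow> r \<in> ideal_power \<aa> (twist_exp t n) \<Longrightarrow> m \<in> N \<Longrightarrow> (k ^^ n) (r *s m) \<in> twist_image t N"
  unfolding twist_image_def by (intro group_closure.base) blast

lemma subspace_twist_image:
  assumes N: "subspace N"
  shows "subspace (twist_image t N)"
  unfolding twist_image_def
proof (rule subspace_group_closure)
  fix c y assume "y \<in> {(k ^^ n) (r *s m) |n r m. 1 \<le> n \<and> r \<in> ideal_power \<aa> (twist_exp t n) \<and> m \<in> N}"
  then obtain n r m where y: "y = (k ^^ n) (r *s m)" "1 \<le> n" "r \<in> ideal_power \<aa> (twist_exp t n)" "m \<in> N"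
    by blast
  have "c *s y = (k ^^ n) (r *s (c ^ (p ^ n) *s m))"
    unfolding y(1) iter_scale[symmetric] by (simp add: mult.commute)
  then show "c *s y \<in> group_closure {(k ^^ n) (r *s m) |n r m.
      1 \<le> n \<and> r \<in> ideal_power \<aa> (twist_exp t n) \<and> m \<in> N}"
    using twist_imageI[OF y(2,3) subspace_scale[OF N y(4)]] unfolding twist_image_def by simp
qed

lemma twist_image_mono: "N \<subseteq> N' \<Longrightarrow> twist_image t N \<subseteq> twist_image t N'"
  unfolding twist_image_def by (intro group_closure_mono) blast

lemma twist_image_contract:
  assumes "m \<in> twist_image t N"
  shows "r *s m \<in> twist_image t ((\<lambda>m. r\<^sup>2 *s m) ` N)"
  using assms unfolding twist_image_def[of t N]
proof induction
  case (base y)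
  show ?case
  proof (cases "y = 0")
    case True
    then show ?thesis by (simp add: twist_image_def)
  next
    case False
    then obtain n s m where y: "y = (k ^^ n) (s *s m)" "1 \<le> n" "s \<in> ideal_power \<aa> (twist_exp t n)" "m \<in> N"
      using base by blast
    have "2 \<le> p ^ n" using power_increasing[OF y(2), of p] p_ge_2 by simp
    then have "r ^ (p ^ n) = r ^ (p ^ n - 2) * r\<^sup>2" by (metis le_add_diff_inverse2 power_add)
    then have "r *s y = (k ^^ n) ((r ^ (p ^ n - 2) * s) *s (r\<^sup>2 *s m))"
      unfolding y(1) iter_scale[symmetric] by (simp add: mult_ac)
    moreover have "r ^ (p ^ n - 2) * s \<in> ideal_power \<aa> (twist_exp t n)"
      by (rule module.subspace_scale[OF module_mult ideal_ideal_power y(3)])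
    ultimately show ?thesis using twist_imageI[OF y(2) _ imageI[OF y(4)]] by metis
  qed
next
  case (diff y z)
  then show ?case unfolding twist_image_def by (simp add: scale_right_diff_distrib group_closure.diff)
qed

lemma twist_image_stabilizes: "\<exists>e0. \<forall>e\<ge>e0. (twist_image t ^^ e) UNIV = (twist_image t ^^ e0) UNIV"
  by (rule contracting_iterates_stabilize[OF subspace_twist_image twist_image_mono twist_image_contract])

lemma subspace_twist_image_iter: "subspace ((twist_image t ^^ e) UNIV)"
  by (induction e) (simp_all add: subspace_twist_image)

text \<open>
  Thus \<open>M\<close> and its stable image under the twisted algebra have the same support and agree at the generic points.
\<close>

lemma power_x_mult_in_twist_image_iter: "\<exists>j. \<forall>m. x ^ j *s m \<in> (twist_image t ^^ e) UNIV"
proof (induction e)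
  case (Suc e)
  then obtain j where j: "\<And>m. x ^ j *s m \<in> (twist_image t ^^ e) UNIV" by blast
  define d where "d = twist_exp t 1"
  have "x ^ (d + j) *s m \<in> (twist_image t ^^ Suc e) UNIV" for m
  proof -
    obtain m' where m': "m = k m'" using k_surj by blast
    \<comment> \<open>\<open>x\<^bsup>d+j\<^esup>k(m') = k(x\<^bsup>(d+j)p\<^esup>m')\<close>, and \<open>(d + j)p \<ge> d + j\<close>\<close>
    have "(d + j) * p = d + (j + (d + j) * (p - 1))" using p_ge_2 by (cases p) (auto simp: algebra_simps)
    then have "(x ^ (d + j)) ^ p = x ^ d * (x ^ j * x ^ ((d + j) * (p - 1)))"
      by (metis power_add power_mult)
    then have eq: "x ^ (d + j) *s m = (k ^^ 1) (x ^ d *s (x ^ j *s (x ^ ((d + j) * (p - 1)) *s m')))"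
      unfolding m' k_scale[symmetric] by simp
    show ?thesis
      unfolding eq unfolding d_def funpow.simps o_apply by (rule twist_imageI[OF order_refl power_x_in j])
  qed
  then show ?case by blast
qed simp

end

section \<open>Modules over principal Cartier algebras\<close>

lemma unital_hom_0: "unital_hom f \<Longrightarrow> f 0 = 0"
  unfolding unital_hom_def by (metis add_cancel_right_right)

lemma unital_hom_diff: "unital_hom f \<Longrightarrow> f (x - y) = f x - f y"
  unfolding unital_hom_def by (metis add_diff_cancel_right' diff_add_cancel)

lemma unital_hom_of_nat:
  fixes f :: "'a::comm_ring_1 \<Rightarrow> 'b::comm_ring_1"
  assumes "unital_hom f"
  shows "f (of_nat n) = of_nat n"
proof (induction n)
  case (Suc n)
  have "f 1 = 1" using assms unfolding unital_hom_def by (metis mult.right_neutral)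
  then show ?case using assms Suc unfolding unital_hom_def by simp
qed (simp add: unital_hom_0[OF assms])

text \<open>
  Since \<open>r\<kappa> = \<kappa>r\<^sup>p\<close>, the elements \<open>r + \<kappa>d\<close> form a subring, which therefore is all of \<open>\<C>\<close>.  Comparing the
  components of degree \<open>n + 1\<close> in \<open>c = r + \<kappa>d\<close> shows that \<open>c\<close> is \<open>\<kappa>\<close> times the component of degree \<open>n\<close> of \<open>d\<close>.
\<close>

lemma homogeneous_factor:
  assumes pca: "principal_cartier_algebra p \<iota> C \<kappa>" and c: "c \<in> C (Suc n)"
  shows "\<exists>d\<in>C n. c = \<kappa> * d"
proof -
  have hom: "unital_hom \<iota>" and closure: "\<And>n. group_closure (C n) = C n"
    and decomp: "\<And>c. \<exists>!f. finite {n. f n \<noteq> 0} \<and> (\<forall>n. f n \<in> C n) \<and> c = (\<Sum>n | f n \<noteq> 0. f n)"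
    and mult: "\<And>i j c d. c \<in> C i \<Longrightarrow> d \<in> C j \<Longrightarrow> c * d \<in> C (i + j)" and C0: "range \<iota> = C 0"
    and comm: "\<And>n r c. c \<in> C n \<Longrightarrow> \<iota> r * c = c * \<iota> (r ^ (p ^ n))"
    and \<kappa>: "\<kappa> \<in> C 1"
    using pca unfolding principal_cartier_algebra_def cartier_algebra_def by simp_all
  have gen: "ring_generated_by (insert \<kappa> (range \<iota>))"
    using pca unfolding principal_cartier_algebra_def by simp
  have \<iota>_mult: "\<iota> (r * s) = \<iota> r * \<iota> s" and \<iota>_1: "d * \<iota> 1 = d" for r s d
    using hom unfolding unital_hom_def by simp_all
  have zero_in: "0 \<in> C n" for n using zero_in_group_closure[of "C n"] closure by simp
  define S where "S = {\<iota> r + \<kappa> * d |r d. True}"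
  have SI: "\<iota> r + \<kappa> * d \<in> S" for r d unfolding S_def by blast
  have "S = UNIV"
  proof (rule gen[unfolded ring_generated_by_def, rule_format], intro conjI ballI)
    show "insert \<kappa> (range \<iota>) \<subseteq> S"
      using SI[of 0 "\<iota> 1"] SI[of _ 0] unital_hom_0[OF hom] \<iota>_1 by auto
    show "0 \<in> S" using SI[of 0 0] unital_hom_0[OF hom] by simp
    fix a b assume "a \<in> S" "b \<in> S"
    then obtain r d s e where ab: "a = \<iota> r + \<kappa> * d" "b = \<iota> s + \<kappa> * e" unfolding S_def by blast
    have "a - b = \<iota> (r - s) + \<kappa> * (d - e)"
      by (simp add: ab unital_hom_diff[OF hom] right_diff_distrib)
    then show "a - b \<in> S" using SI by simp
    have "\<iota> r * (\<kappa> * e) = \<kappa> * (\<iota> (r ^ p) * e)"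
      using comm[OF \<kappa>, of r] by (simp flip: mult.assoc)
    then have "a * b = \<iota> (r * s) + \<kappa> * (\<iota> (r ^ p) * e + d * b)"
      by (simp add: ab \<iota>_mult distrib_left distrib_right mult.assoc)
    then show "a * b \<in> S" using SI by simp
  qed
  then obtain r d where c_eq: "c = \<iota> r + \<kappa> * d" unfolding S_def by blast
  obtain f where f: "finite {n. f n \<noteq> 0}" "\<And>n. f n \<in> C n" "d = (\<Sum>n | f n \<noteq> 0. f n)"
    using decomp[of d] by blast
  \<comment> \<open>the two decompositions of \<open>c\<close> into homogeneous components that are compared\<close>
  define g where "g i = (if i = Suc n then c else 0)" for i
  define h where "h i = (case i of 0 \<Rightarrow> \<iota> r | Suc j \<Rightarrow> \<kappa> * f j)" for i
  have "finite {i. g i \<noteq> 0}" by (rule finite_subset[of _ "{Suc n}"]) (auto simp: g_def)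
  moreover have "\<forall>i. g i \<in> C i" using c zero_in by (simp add: g_def)
  moreover have "c = (\<Sum>i | g i \<noteq> 0. g i)"
  proof -
    have "(\<Sum>i | g i \<noteq> 0. g i) = (\<Sum>i\<in>{Suc n}. g i)"
      by (rule sum.mono_neutral_left) (auto simp: g_def)
    then show ?thesis by (simp add: g_def)
  qed
  moreover have hsup: "{i. h i \<noteq> 0} \<subseteq> insert 0 (Suc ` {j. f j \<noteq> 0})"
  proof
    fix i assume "i \<in> {i. h i \<noteq> 0}"
    then show "i \<in> insert 0 (Suc ` {j. f j \<noteq> 0})" by (cases i) (auto simp: h_def)
  qed
  then have "finite {i. h i \<noteq> 0}" by (rule finite_subset) (use f(1) in simp)
  moreover have "\<forall>i. h i \<in> C i"
    using C0 mult[OF \<kappa> f(2)] by (auto simp: h_def split: nat.split)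
  moreover have "c = (\<Sum>i | h i \<noteq> 0. h i)"
  proof -
    have "(\<Sum>i | h i \<noteq> 0. h i) = (\<Sum>i\<in>insert 0 (Suc ` {j. f j \<noteq> 0}). h i)"
      using hsup f(1) by (intro sum.mono_neutral_left) auto
    also have "\<dots> = h 0 + (\<Sum>j | f j \<noteq> 0. h (Suc j))"
      using f(1) by (subst sum.insert) (auto simp: sum.reindex)
    also have "\<dots> = c" by (simp add: h_def c_eq f(3) sum_distrib_left)
    finally show ?thesis ..
  qed
  ultimately have "g = h" using decomp[of c] by blast
  then have "c = h (Suc n)" by (simp add: g_def fun_eq_iff split: if_splits)
  then show ?thesis using f(2)[of n] by (auto simp: h_def)
qed

locale F_regular_cartier_module =
  fixes p :: nat and \<iota> :: "'r::comm_ring_1 \<Rightarrow> 'c::ring" and C :: "nat \<Rightarrow> 'c set" and \<kappa> :: 'c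
    and scale :: "'r \<Rightarrow> 'm::ab_group_add \<Rightarrow> 'm" (infixr \<open>*s\<close> 75) and act :: "'c \<Rightarrow> 'm \<Rightarrow> 'm"
  assumes p: "prime p" and noetherian: "noetherian TYPE('r)"
    and principal: "principal_cartier_algebra p \<iota> C \<kappa>"
    and cartier: "cartier_module \<iota> scale act"
    and fin_gen: "fin_gen scale UNIV"
    and F_regular: "F_regular scale act C"
begin

lemma module_scale: "module scale"
  and act_add_right: "act c (m + m') = act c m + act c m'"
  and act_add_left: "act (c + d) m = act c m + act d m"
  and act_mult: "act (c * d) m = act c (act d m)"
  and act_\<iota>: "act (\<iota> r) m = r *s m"
  using cartier unfolding cartier_module_def by simp_all

lemma act_diff_left: "act (c - d) m = act c m - act d m"
  using act_add_left[of "c - d" d m] by simp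

lemma act_0_left: "act 0 m = 0"
  using act_add_left[of 0 0 m] by simp

lemma C_0: "C 0 = range \<iota>" and \<kappa>_in: "\<kappa> \<in> C 1"
  and C_mult: "c \<in> C i \<Longrightarrow> d \<in> C j \<Longrightarrow> c * d \<in> C (i + j)"
  and C_commute: "c \<in> C n \<Longrightarrow> \<iota> r * c = c * \<iota> (r ^ (p ^ n))"
  using principal unfolding principal_cartier_algebra_def cartier_algebra_def by simp_all

text \<open>
  By iterated factorization the elements of \<open>\<C>\<^sub>n\<close> act like those of \<open>\<kappa>\<^sup>nR\<close>, so the action of \<open>\<C>\<close> is determined by
  the action of \<open>\<kappa>\<close>.
\<close>

lemma act_homogeneous: "c \<in> C n \<Longrightarrow> \<exists>r. \<forall>m. act c m = (act \<kappa> ^^ n) (r *s m)"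
proof (induction n arbitrary: c)
  case 0
  then show ?case by (auto simp: C_0 act_\<iota>)
next
  case (Suc n)
  then obtain d where d: "d \<in> C n" "c = \<kappa> * d" using homogeneous_factor[OF principal] by blast
  then obtain r where "\<forall>m. act d m = (act \<kappa> ^^ n) (r *s m)" using Suc.IH by blast
  then have "\<forall>m. act c m = (act \<kappa> ^^ Suc n) (r *s m)" by (simp add: d act_mult)
  then show ?case by blast
qed

lemma homogeneous_iterate: "\<exists>c\<in>C n. \<forall>m. act c m = (act \<kappa> ^^ n) m"
proof (induction n)
  case 0
  have "act (\<iota> 1) m = m" for m using module.scale_one[OF module_scale] by (simp add: act_\<iota>)
  then show ?case by (auto simp: C_0)
next
  case (Suc n)
  then obtain c where c: "c \<in> C n" "\<forall>m. act c m = (act \<kappa> ^^ n) m" by blast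
  then have "\<kappa> * c \<in> C (Suc n)" "\<forall>m. act (\<kappa> * c) m = (act \<kappa> ^^ Suc n) m"
    using C_mult[OF \<kappa>_in] by (simp_all add: act_mult)
  then show ?case by blast
qed

lemma iterate_mem:
  assumes "act \<kappa> ` N \<subseteq> N" "m \<in> N"
  shows "(act \<kappa> ^^ n) m \<in> N"
  using assms by (induction n) auto

lemma act_\<kappa>_scale: "act \<kappa> (r ^ p *s m) = r *s act \<kappa> m"
  using C_commute[OF \<kappa>_in, of r] by (metis act_\<iota> act_mult power_one_right)

lemma act_\<kappa>_surj: "range (act \<kappa>) = UNIV"
proof -
  have "plus_image act C UNIV \<subseteq> range (act \<kappa>)"
    unfolding plus_image_def
  proof (rule group_closure_subsetI)
    show "{act c m |c m n. 1 \<le> n \<and> c \<in> C n \<and> m \<in> UNIV} \<subseteq> range (act \<kappa>)"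
    proof clarify
      fix c m and n :: nat assume "1 \<le> n" "c \<in> C n"
      then obtain d where "c = \<kappa> * d"
        using homogeneous_factor[OF principal, of c "n - 1"] by auto
      then show "act c m \<in> range (act \<kappa>)" by (simp add: act_mult)
    qed
    have "act \<kappa> 0 = 0" using act_add_right[of \<kappa> 0 0] by simp
    then show "0 \<in> range (act \<kappa>)" by (metis rangeI)
    fix y z assume "y \<in> range (act \<kappa>)" "z \<in> range (act \<kappa>)"
    then obtain a b where "y = act \<kappa> a" "z = act \<kappa> b" by blast
    then have "y - z = act \<kappa> (a - b)" using act_add_right[of \<kappa> "a - b" b] by simp
    then show "y - z \<in> range (act \<kappa>)" by simp
  qed
  then show ?thesis using F_regular by (auto simp: F_regular_def F_pure_def)
qed

sublocale F_regular_module scale p "act \<kappa>"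
proof -
  interpret module scale by (rule module_scale)
  show "F_regular_module scale p (act \<kappa>)"
  proof
    fix N
    assume N: "subspace N" "act \<kappa> ` N \<subseteq> N" "N \<noteq> {0}"
      and loc: "\<forall>P\<in>generic_points scale UNIV. localized scale P N = localized scale P UNIV"
    have "act c m \<in> N" if "c \<in> C n" "m \<in> N" for c m n
    proof -
      obtain r where "act c m = (act \<kappa> ^^ n) (r *s m)" using act_homogeneous[OF \<open>c \<in> C n\<close>] by blast
      then show ?thesis using iterate_mem[OF N(2) subspace_scale[OF N(1) \<open>m \<in> N\<close>]] by simp
    qed
    then have "cartier_submodule scale act C N" using N(1) by (simp add: cartier_submodule_def)
    then show "N = UNIV" using F_regular N(3) loc unfolding F_regular_def by blast
  qed (use noetherian fin_gen p act_add_right act_\<kappa>_scale act_\<kappa>_surj in \<open>simp_all add: prime_ge_2_nat\<close>)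
qed

end

locale F_regular_cartier_module_with_ideal =
  F_regular_cartier_module p \<iota> C \<kappa> scale act + F_regular_module_with_ideal scale p "act \<kappa>" \<aa> x
  for p and \<iota> :: "'r::comm_ring_1 \<Rightarrow> 'c::ring" and C \<kappa>
    and scale :: "'r \<Rightarrow> 'm::ab_group_add \<Rightarrow> 'm" (infixr \<open>*s\<close> 75) and act \<aa> x
begin

text \<open>
  Reduces statements on the twisted component of degree \<open>n\<close>, an additive closure, to its elements that act as
  \<open>\<kappa>\<^sup>nr\<close> with \<open>r\<close> in the prescribed power of \<open>\<aa>\<close>.
\<close>

lemma act_twist_induct [consumes 1, case_names zero diff base]:
  assumes "c \<in> twist p \<iota> C \<aa> t n"
    and "P 0" "\<And>y z. P y \<Longrightarrow> P z \<Longrightarrow> P (y - z)"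
    and "\<And>r. r \<in> ideal_power \<aa> (twist_exp t n) \<Longrightarrow> P ((act \<kappa> ^^ n) (r *s m))"
  shows "P (act c m)"
  using assms(1) unfolding twist_def
proof induction
  case (base c)
  show ?case
  proof (cases "c = 0")
    case False
    then obtain d r where d: "c = d * \<iota> r" "d \<in> C n" "r \<in> ideal_power \<aa> (twist_exp t n)"
      using base by (auto simp: twist_exp_def)
    obtain s where s: "\<forall>m. act d m = (act \<kappa> ^^ n) (s *s m)" using act_homogeneous[OF d(2)] by blast
    have "s * r \<in> ideal_power \<aa> (twist_exp t n)"
      by (rule module.subspace_scale[OF module_mult ideal_ideal_power d(3)])
    then show ?thesis using assms(4)[of "s * r"] s by (simp add: d(1) act_mult act_\<iota>)
  qed (simp add: act_0_left assms(2))
qed (simp add: act_diff_left assms(3))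

lemma twist_element:
  assumes "r \<in> ideal_power \<aa> (twist_exp t n)"
  shows "\<exists>c\<in>twist p \<iota> C \<aa> t n. \<forall>m. act c m = (act \<kappa> ^^ n) (r *s m)"
proof -
  obtain c where c: "c \<in> C n" "\<forall>m. act c m = (act \<kappa> ^^ n) m" using homogeneous_iterate by blast
  have "c * \<iota> r \<in> twist p \<iota> C \<aa> t n"
    unfolding twist_def using c(1) assms by (intro group_closure.base) (auto simp: twist_exp_def)
  moreover have "\<forall>m. act (c * \<iota> r) m = (act \<kappa> ^^ n) (r *s m)" using c(2) by (simp add: act_mult act_\<iota>)
  ultimately show ?thesis by blast
qed

lemma cartier_submodule_twist_iff:
  "cartier_submodule scale act (twist p \<iota> C \<aa> t) N \<longleftrightarrow> subspace N \<and> twist_stable t N"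
proof -
  have "act c m \<in> N"
    if "subspace N" "twist_stable t N" "c \<in> twist p \<iota> C \<aa> t n" "m \<in> N" for c m n
    using that(3)
  proof (induction rule: act_twist_induct)
    case (base r)
    then show ?case using that(2,4) unfolding twist_stable_def by blast
  qed (use that(1) subspace_0 subspace_diff in auto)
  moreover have "twist_stable t N"
    if "\<And>n c m. c \<in> twist p \<iota> C \<aa> t n \<Longrightarrow> m \<in> N \<Longrightarrow> act c m \<in> N"
    unfolding twist_stable_def using that twist_element by metis
  ultimately show ?thesis unfolding cartier_submodule_def by blast
qed

lemma plus_image_twist: "plus_image act (twist p \<iota> C \<aa> t) N = twist_image t N"
proof
  show "plus_image act (twist p \<iota> C \<aa> t) N \<subseteq> twist_image t N"
    unfolding plus_image_def
  proof (rule group_closure_subsetI)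
    show "{act c m |c m n. 1 \<le> n \<and> c \<in> twist p \<iota> C \<aa> t n \<and> m \<in> N} \<subseteq> twist_image t N"
    proof clarify
      fix c m and n :: nat assume n: "1 \<le> n" and c: "c \<in> twist p \<iota> C \<aa> t n" and m: "m \<in> N"
      show "act c m \<in> twist_image t N"
        using c
      proof (induction rule: act_twist_induct)
        case (base r)
        then show ?case by (intro twist_imageI n m)
      qed (simp_all add: twist_image_def group_closure.diff)
    qed
  qed (simp_all add: twist_image_def group_closure.diff)
  show "twist_image t N \<subseteq> plus_image act (twist p \<iota> C \<aa> t) N"
    unfolding twist_image_def plus_image_def
  proof (rule group_closure_mono, clarify)
    fix n r m assume "1 \<le> n" and r: "r \<in> ideal_power \<aa> (twist_exp t n)" and "m \<in> N"
    then show "\<exists>c m' n'. (act \<kappa> ^^ n) (r *s m) = act c m' \<and> 1 \<le> n' \<and> c \<in> twist p \<iota> C \<aa> t n' \<and> m' \<in> N"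
      using twist_element[OF r] by metis
  qed
qed

lemma stable_image_twist: "\<exists>e. stable_image act (twist p \<iota> C \<aa> t) = (twist_image t ^^ e) UNIV"
proof -
  have "plus_image act (twist p \<iota> C \<aa> t) = twist_image t" by (rule ext) (rule plus_image_twist)
  moreover obtain e0 where e0: "\<forall>e\<ge>e0. (twist_image t ^^ e) UNIV = (twist_image t ^^ e0) UNIV"
    using twist_image_stabilizes by blast
  have "(THE U. \<forall>\<^sub>F e in sequentially. (twist_image t ^^ e) UNIV = U) = (twist_image t ^^ e0) UNIV"
  proof (rule the_equality)
    show ev: "\<forall>\<^sub>F e in sequentially. (twist_image t ^^ e) UNIV = (twist_image t ^^ e0) UNIV"
      unfolding eventually_sequentially using e0 by blast
    fix U assume "\<forall>\<^sub>F e in sequentially. (twist_image t ^^ e) UNIV = U"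
    with ev have "\<forall>\<^sub>F e in sequentially. U = (twist_image t ^^ e0) UNIV"
      by eventually_elim simp
    then show "U = (twist_image t ^^ e0) UNIV" by simp
  qed
  ultimately show ?thesis unfolding stable_image_def by auto
qed

lemma is_test_module_V:
  assumes t: "t \<ge> 0"
  shows "is_test_module scale act (twist p \<iota> C \<aa> t) (V t)"
proof -
  define U where "U = stable_image act (twist p \<iota> C \<aa> t)"
  obtain e where e: "U = (twist_image t ^^ e) UNIV" using stable_image_twist unfolding U_def by blast
  then have U: "subspace U" by (simp add: subspace_twist_image_iter)
  obtain i where i: "\<And>m. x ^ i *s m \<in> U" using power_x_mult_in_twist_image_iter unfolding e by blast
  obtain j where j: "\<And>m. x ^ j *s m \<in> V t" using power_x_mult_in_V by blast
  have reg: "x ^ n *s m = 0 \<Longrightarrow> m = 0" for n m by (rule regular_power[OF x_regular])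
  have gen: "generic_points scale U = generic_points scale UNIV"
    unfolding generic_points_def using supp_eq_UNIV[OF reg U i] by simp
  have prime: "prime_ideal P" and notin: "x ^ n \<notin> P" if "P \<in> generic_points scale UNIV" for P n
    using that regular_notin_generic_point[OF reg that]
    by (auto simp: generic_points_UNIV minimal_prime_over_def)
  have locU: "localized scale P U = localized scale P UNIV" if "P \<in> generic_points scale UNIV" for P
    using localized_eq_UNIV[OF prime[OF that] notin[OF that] i] .
  have locV: "localized scale P (V t) = localized scale P UNIV" if "P \<in> generic_points scale UNIV" for P
    using localized_eq_UNIV[OF prime[OF that] notin[OF that] j] .
  show ?thesis
    unfolding is_test_module_def Let_def U_def[symmetric] gen cartier_submodule_twist_iff
    using subspace_V twist_stable_V locU locV V_minimal[OF t] by simp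
qed

lemma is_V_filtration_V:
  assumes char: "of_nat p = (0 :: 'r)" and x_nz: "x \<noteq> 0"
  shows "is_V_filtration p scale (act \<kappa>) \<aa> V"
proof -
  have "CHAR('r) dvd p" using char by (simp add: of_nat_eq_0_iff_char_dvd)
  then have "CHAR('r) = 1 \<or> CHAR('r) = p" using p unfolding prime_nat_iff by blast
  then have char_r: "CHAR('r) = p" using CHAR_not_1[where 'a = 'r] by simp
  have frob: "(a + b) ^ p = a ^ p + b ^ p" for a b :: 'r
    by (rule freshmans_dream) (simp_all add: char_r p)
  have "module (frob_scale p 1 scale)"
    by unfold_locales (simp_all add: frob_scale_def frob scale_left_distrib scale_right_distrib power_mult_distrib)
  then have "principal_cartier_module p scale (act \<kappa>)"
    unfolding principal_cartier_module_def module_hom_iff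
    by (simp add: module_axioms act_add_right frob_scale_def act_\<kappa>_scale)
  moreover have right: "\<exists>\<delta>>0. \<forall>\<epsilon>. 0 < \<epsilon> \<and> \<epsilon> < \<delta> \<longrightarrow> V (t + \<epsilon>) = V t" for t
  proof -
    obtain \<delta> where \<delta>: "\<delta> > 0" "V (t + \<delta>) = V t" using V_right_continuous by blast
    have "V (t + \<epsilon>) = V t" if "0 < \<epsilon>" "\<epsilon> < \<delta>" for \<epsilon>
      using antimonoD[OF V_antimono, of t "t + \<epsilon>"] antimonoD[OF V_antimono, of "t + \<epsilon>" "t + \<delta>"] \<delta> that
      by auto
    then show ?thesis using \<delta>(1) by blast
  qed
  moreover have "(\<Union>t. V t) = UNIV" using V_nonpos[of 0] by auto
  moreover have "fin_gen scale (V 0)" using fin_gen by (simp add: V_nonpos)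
  moreover have "\<exists>\<delta>>0. \<forall>s. \<bar>s\<bar> < \<delta> \<longrightarrow> V s = V 0"
  proof -
    obtain \<delta> where \<delta>: "\<delta> > 0" "\<forall>\<epsilon>. 0 < \<epsilon> \<and> \<epsilon> < \<delta> \<longrightarrow> V (0 + \<epsilon>) = V 0" using right by blast
    have "V s = V 0" if "\<bar>s\<bar> < \<delta>" for s
      using \<delta>(2) that V_nonpos[of s] V_nonpos[of 0] by (cases "s \<le> 0") auto
    then show ?thesis using \<delta>(1) by blast
  qed
  moreover have "scale (x ^ j) ` V t \<subseteq> V (t + of_nat j) \<and> inj_on (scale (x ^ j)) (V t)" for t j
  proof
    show "scale (x ^ j) ` V t \<subseteq> V (t + of_nat j)" using V_mult[OF power_x_in] by blast
    show "inj_on (scale (x ^ j)) (V t)"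
    proof (rule inj_onI)
      fix m m' assume "x ^ j *s m = x ^ j *s m'"
      then have "x ^ j *s (m - m') = 0" by (simp add: scale_right_diff_distrib)
      from regular_power[OF x_regular this] have "m - m' = 0" .
      then show "m = m'" by simp
    qed
  qed
  then have "\<exists>x\<in>\<aa>. x \<noteq> 0 \<and> (\<forall>t. \<forall>j::nat.
      scale (x ^ j) ` V t \<subseteq> V (t + of_nat j) \<and> inj_on (scale (x ^ j)) (V t))"
    using x_in x_nz by blast
  moreover have "\<forall>X. finite X \<and> module.span (*) X = \<aa> \<longrightarrow>
      (\<forall>t > of_nat (card X). V t = ideal_times scale \<aa> (V (t - 1)))"
    using V_skoda by blast
  ultimately show ?thesis
    unfolding is_V_filtration_def
    by (intro conjI) (simp_all only: subspace_V V_antimono k_image_V simp_thms)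
qed

end

theorem theorem3p3:
  fixes p :: nat
    and f :: "'k::field \<Rightarrow> 'b::comm_ring_1"
    and l :: "'b \<Rightarrow> 'r::comm_ring_1"
    and \<aa> :: "'r set"
    and \<iota> :: "'r \<Rightarrow> 'c::ring"
    and C :: "nat \<Rightarrow> 'c set"
    and \<kappa> :: 'c
    and scale :: "'r \<Rightarrow> 'm::ab_group_add \<Rightarrow> 'm"
    and act :: "'c \<Rightarrow> 'm \<Rightarrow> 'm"
  assumes "prime p" and "CHAR('k) = p" and "F_finite p TYPE('k)"
    and "ess_finite_type f l" and "noetherian TYPE('r)"
    and "module.subspace (*) \<aa>"
    and "principal_cartier_algebra p \<iota> C \<kappa>"
    and "cartier_module \<iota> scale act"
    and "fin_gen scale UNIV"
    and "F_regular scale act C"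
    and "\<exists>x\<in>\<aa>. regular_element scale x"
  shows "\<exists>V. is_V_filtration p scale (act \<kappa>) \<aa> V \<and>
           (\<forall>t\<ge>0. is_test_module scale act (twist p \<iota> C \<aa> t) (V t)) \<and>
           (\<forall>t<0. V t = UNIV)"
proof -
  obtain x where x: "x \<in> \<aa>" "x \<noteq> 0" "\<And>m. scale x m = 0 \<Longrightarrow> m = 0"
    using assms(11) by (auto simp: regular_element_def)
  interpret F_regular_cartier_module p \<iota> C \<kappa> scale act
    by (rule F_regular_cartier_module.intro) (fact assms)+
  interpret F_regular_cartier_module_with_ideal p \<iota> C \<kappa> scale act \<aa> x
    by unfold_locales (fact assms(6) x)+
  have hom: "unital_hom f" "unital_hom l"
    using assms(4) by (auto simp: ess_finite_type_def finite_type_def is_localization_def)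
  have "of_nat p = (0 :: 'k)" using of_nat_CHAR[where 'a='k] assms(2) by simp
  then have "of_nat p = (0 :: 'b)"
    using unital_hom_of_nat[OF hom(1), of p] unital_hom_0[OF hom(1)] by simp
  then have "of_nat p = (0 :: 'r)"
    using unital_hom_of_nat[OF hom(2), of p] unital_hom_0[OF hom(2)] by simp
  then have "is_V_filtration p scale (act \<kappa>) \<aa> V" using x(2) by (rule is_V_filtration_V)
  then show ?thesis using is_test_module_V V_nonpos by (intro exI[of _ V]) auto
qed

end
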